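(* Let $k\geq 4$ be an integer. Then $r_k(k+1,k-1;n) = \mathrm{twr}_{k-2}(n^{\Theta(1)})$; that is, there exist constants $c,c'>0$ depending only on $k$ such that for all sufficiently large $n$, \[\mathrm{twr}_{k-2}(n^{c}) < r_k(k+1,k-1;n) < \mathrm{twr}_{k-2}(n^{c'}).\]
   Context: For integers $2\leq k<n$ and $2\leq t\leq k+1$, $r_k(k+1,t;n)$ denotes the minimum integer $N$ such that for every red/blue coloring of the $k$-element subsets of $[N]=\{1,\dots,N\}$, there is either a set of $k+1$ integers at least $t$ of whose $k$-element subsets are colored red, or a set of $n$ integers all of whose $k$-element subsets are colored blue. The tower function is defined by $\mathrm{twr}_1(x)=x$ and $\mathrm{twr}_{i+1}(x)=2^{\mathrm{twr}_i(x)}$. *)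

theory Defs
  imports Complex_Main "HOL-Library.Ramsey"
begin

datatype colour = Red | Blue

text \<open>A colouring is a total function on sets of naturals, but only its values on
  the \<open>k\<close>-element subsets of \<open>{1..N}\<close> matter.\<close>

definition eh_arrow :: "nat \<Rightarrow> nat \<Rightarrow> nat \<Rightarrow> nat \<Rightarrow> bool" where
  "eh_arrow N k t n \<longleftrightarrow>
     (\<forall>\<chi> :: nat set \<Rightarrow> colour.
        (\<exists>S \<in> nsets {1..N} (k + 1). card {e \<in> nsets S k. \<chi> e = Red} \<ge> t) \<or>
        (\<exists>S \<in> nsets {1..N} n. \<forall>e \<in> nsets S k. \<chi> e = Blue))"

text \<open>The Erdos--Hajnal hypergraph Ramsey number \<open>r\<^sub>k(k + 1, t; n)\<close>, intended for
  \<open>2 \<le> k < n\<close> and \<open>2 \<le> t \<le> k + 1\<close>; the minimum exists by \<open>eh_arrow_exists\<close> below.\<close>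

definition eh_ramsey :: "nat \<Rightarrow> nat \<Rightarrow> nat \<Rightarrow> nat" where
  "eh_ramsey k t n = (LEAST N. eh_arrow N k t n)"

lemma eh_arrow_exists:
  assumes "t \<le> k + 1"
  shows "\<exists>N. eh_arrow N k t n"
proof -
  obtain N :: nat where N: "partn_lst {..<N} [k + 1, n] k"
    using ramsey_full by blast
  have "eh_arrow N k t n"
    unfolding eh_arrow_def
  proof
    fix \<chi> :: "nat set \<Rightarrow> colour"
    define f where "f e = (if \<chi> (Suc ` e) = Red then 0 else 1 :: nat)" for e
    have "f \<in> nsets {..<N} k \<rightarrow> {..<length [k + 1, n]}"
      by (auto simp: f_def)
    then obtain i where i: "i < length [k + 1, n]" and "monochromatic {..<N} ([k + 1, n] ! i) k f i"
      using N unfolding partn_lst_def by blast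
    then obtain H where H: "H \<in> nsets {..<N} ([k + 1, n] ! i)"
      and fH: "f ` nsets H k \<subseteq> {i}"
      unfolding monochromatic_def by blast
    have S: "Suc ` H \<in> nsets {1..N} ([k + 1, n] ! i)"
      using H by (auto simp: nsets_def card_image)
    have col: "(\<chi> e = Red) = (i = 0)" if "e \<in> nsets (Suc ` H) k" for e
    proof -
      have e: "e \<subseteq> Suc ` H" "finite e" "card e = k"
        using that unfolding nsets_def by blast+
      obtain d where d: "d \<subseteq> H" "e = Suc ` d"
        using e(1) by (rule subset_imageE)
      have "finite d" "card d = k"
        using e(2,3) unfolding d(2) by (simp_all add: finite_image_iff card_image)
      with d(1) have "d \<in> nsets H k"
        by (simp add: nsets_def)
      then have "f d = i" using fH by blast
      then show ?thesis using d by (cases "\<chi> e = Red") (simp_all add: f_def)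
    qed
    show "(\<exists>S\<in>nsets {1..N} (k + 1). t \<le> card {e \<in> nsets S k. \<chi> e = Red}) \<or>
          (\<exists>S\<in>nsets {1..N} n. \<forall>e\<in>nsets S k. \<chi> e = Blue)"
    proof (cases "i = 0")
      case True
      have "{e \<in> nsets (Suc ` H) k. \<chi> e = Red} = nsets (Suc ` H) k"
        using col True by blast
      moreover have S': "Suc ` H \<in> nsets {1..N} (k + 1)"
        using S True by simp
      moreover have "card (nsets (Suc ` H) k) = k + 1"
      proof -
        have "finite (Suc ` H)" "card (Suc ` H) = k + 1"
          using S' unfolding nsets_def by blast+
        then show ?thesis
          using n_subsets[of "Suc ` H" k] binomial_symmetric[of k "k + 1"]
          by (simp add: card_nsets)
      qed
      ultimately show ?thesis using assms by (intro disjI1 bexI[of _ "Suc ` H"]) auto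
    next
      case False
      then have "Suc ` H \<in> nsets {1..N} n" using S i by (cases i) auto
      moreover have "\<chi> e = Blue" if "e \<in> nsets (Suc ` H) k" for e
        using col[OF that] False by (cases "\<chi> e") auto
      ultimately show ?thesis by blast
    qed
  qed
  then show ?thesis ..
qed

text \<open>The tower function is indexed from 1; \<open>twr 0\<close> is left unspecified.\<close>

fun twr :: "nat \<Rightarrow> real \<Rightarrow> real" where
  "twr (Suc 0) x = x"
| "twr (Suc (Suc i)) x = 2 powr twr (Suc i) x"

end

theory Submission
  imports Defs
begin

text \<open>
  Lower bound. The vertices are the subsets of \<open>{..<M}\<close>, read as binary words with the largest element
  as the leading digit; a set of vertices is a binary tree whose nodes carry as level the digit at
  which they split. In each stepping-up from \<open>k\<close> to \<open>k + 1\<close>, a set of \<open>k + 1\<close> vertices whose tree is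
  a comb inherits the colour of its set of \<open>k\<close> levels. Passing from \<open>k + 2\<close> vertices of a comb to
  their levels loses one red edge, and a set of \<open>k + 2\<close> vertices that is not a comb contains at
  most three combs of size \<open>k + 1\<close>. To exclude large blue sets without long combs, some further
  trees are made red. For edges of size at least \<open>6\<close> these are the trees with exactly three leaves
  left of the root: a set avoiding them has at every node a small side, hence is essentially a long path.
  For edges of size \<open>4\<close> (where no comb is red) they are the trees with two leaves on either side
  of the root and equal levels there: a set avoiding them has pairwise distinct levels.
  For edges of size \<open>5\<close> a tree \<open>((a b) ((c d) e))\<close> is red if a random tournament orients the level of
  \<open>{a, b}\<close> differently towards the levels of \<open>{c, d}\<close> and \<open>{c, d, e}\<close>. A blue set then has at least
  about the square root of its size many levels, and two subtrees in the position of \<open>{a, b}\<close> and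
  \<open>{c, d}\<close> share at most one level; since the tournament has no large bipartite pattern with constant
  rows, one of the two is small, and again only a long path is left.

  Upper bound. The Erdos-Rado argument passes from \<open>k + 1\<close> to \<open>k\<close> at the cost of one exponential,
  provided that the \<open>k - 1\<close> red edges are required to include the one without the largest vertex. For
  \<open>k = 3\<close> this ordered version holds with a quadratic bound.
\<close>

subsection \<open>Sets of binary words as trees\<close>

text \<open>Union minus intersection is where the members disagree, so this is the level of the
  root. The value is meaningless for fewer than two vertices.\<close>

definition branch :: "nat set set \<Rightarrow> nat" where
  "branch S = Max (\<Union>S - \<Inter>S)"

definition side :: "bool \<Rightarrow> nat set set \<Rightarrow> nat set set" where
  "side b S = {u \<in> S. (branch S \<in> u) = b}"

text \<open>Ranging over all subsets yields exactly the nodes: a subset branches where its lowest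
  common ancestor does. Equal levels at different nodes are counted once.\<close>

definition levels :: "nat set set \<Rightarrow> nat set" where
  "levels S = branch ` {T. T \<subseteq> S \<and> 2 \<le> card T}"

text \<open>Every node of a comb has a single leaf on side \<open>b\<close>; in terms of consecutive branching levels,
  these are the monotone sets.\<close>

definition comb :: "bool \<Rightarrow> nat set set \<Rightarrow> bool" where
  "comb b S \<longleftrightarrow> (\<forall>T \<subseteq> S. card T = 3 \<longrightarrow> card (side b T) = 1)"

lemma side_subset: "side b S \<subseteq> S"
  by (auto simp: side_def)

lemma side_Un: "side b S \<union> side (\<not> b) S = S"
  by (auto simp: side_def)

lemma side_disjoint: "side b S \<inter> side (\<not> b) S = {}"
  by (auto simp: side_def)

lemma sides_cover: "side False S \<union> side True S = S" "side False S \<inter> side True S = {}"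
  by (auto simp: side_def)

lemma finite_vertices: "S \<subseteq> Pow {..<M::nat} \<Longrightarrow> finite S"
  using finite_subset[of S "Pow {..<M}"] by simp

lemma card_sides: "finite S \<Longrightarrow> card (side b S) + card (side (\<not> b) S) = card S"
  by (metis card_Un_disjoint finite_subset side_Un side_disjoint side_subset)

lemma two_elements:
  assumes "2 \<le> card S"
  obtains u v where "u \<in> S" "v \<in> S" "u \<noteq> v"
proof -
  have "finite S" using assms by (metis card.infinite not_numeral_le_zero)
  then have "\<not> (\<forall>u\<in>S. \<forall>v\<in>S. u = v)" using assms card_le_Suc0_iff_eq[of S] by force
  then show ?thesis using that by blast
qed

lemma branch_mem:
  assumes "S \<subseteq> Pow {..<M::nat}" "2 \<le> card S"
  shows "branch S \<in> \<Union>S - \<Inter>S"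
proof -
  obtain u v where uv: "u \<in> S" "v \<in> S" "u \<noteq> v"
    using two_elements assms(2) by blast
  then have "\<Union>S - \<Inter>S \<noteq> {}" by blast
  moreover have "finite (\<Union>S - \<Inter>S)"
    by (rule finite_subset[of _ "{..<M}"]) (use assms(1) in auto)
  ultimately show ?thesis unfolding branch_def by (rule Max_in[rotated])
qed

lemma side_nonempty:
  assumes "S \<subseteq> Pow {..<M::nat}" "2 \<le> card S"
  shows "side b S \<noteq> {}"
  using branch_mem[OF assms] by (cases b) (auto simp: side_def)

lemma card_side_pos:
  assumes "S \<subseteq> Pow {..<M::nat}" "2 \<le> card S"
  shows "0 < card (side b S)"
  using side_nonempty[OF assms] finite_vertices[OF assms(1)] finite_subset[OF side_subset]
  by (simp add: card_gt_0_iff)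

lemma card_side_less:
  assumes "S \<subseteq> Pow {..<M::nat}" "2 \<le> card S"
  shows "card (side b S) < card S"
  using card_sides[OF finite_vertices[OF assms(1)], of b] card_side_pos[OF assms, of "\<not> b"]
  by linarith

text \<open>Two vertices on opposite sides already disagree at the root digit, and a subset
  disagrees at no higher digit than \<open>S\<close>.\<close>

lemma branch_eqI:
  assumes "S \<subseteq> Pow {..<M::nat}" "T \<subseteq> S" "T \<inter> side False S \<noteq> {}" "T \<inter> side True S \<noteq> {}"
  shows "branch T = branch S"
proof -
  have fin: "finite (\<Union>S - \<Inter>S)"
    by (rule finite_subset[of _ "{..<M}"]) (use assms(1) in auto)
  have sub: "\<Union>T - \<Inter>T \<subseteq> \<Union>S - \<Inter>S" using assms(2,3) by blast
  have "branch S \<in> \<Union>T - \<Inter>T" using assms(3,4) by (auto simp: side_def)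
  moreover have "y \<le> branch S" if "y \<in> \<Union>T - \<Inter>T" for y
    using Max_ge[OF fin, of y] sub that by (auto simp: branch_def)
  moreover have "finite (\<Union>T - \<Inter>T)" using fin sub finite_subset by blast
  ultimately show ?thesis unfolding branch_def[of T] by (intro Max_eqI) auto
qed

lemma side_eqI:
  assumes "S \<subseteq> Pow {..<M::nat}" "T \<subseteq> S" "T \<inter> side False S \<noteq> {}" "T \<inter> side True S \<noteq> {}"
  shows "side b T = T \<inter> side b S"
  using branch_eqI[OF assms] assms(2) by (auto simp: side_def)

lemma branch_less:
  assumes "S \<subseteq> Pow {..<M::nat}" "T \<subseteq> side b S" "2 \<le> card T"
  shows "branch T < branch S"
proof -
  have TS: "T \<subseteq> S" using assms(2) side_subset by blast
  have fin: "finite (\<Union>S - \<Inter>S)"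
    by (rule finite_subset[of _ "{..<M}"]) (use assms(1) in auto)
  have T: "branch T \<in> \<Union>T - \<Inter>T"
    using branch_mem[of T M] TS assms by auto
  have "branch T \<in> \<Union>S - \<Inter>S" using T TS by blast
  then have "branch T \<le> branch S" using Max_ge[OF fin] by (simp add: branch_def)
  moreover have "branch T \<noteq> branch S"
    using T assms(2) by (cases b) (auto simp: side_def)
  ultimately show ?thesis by simp
qed

lemma subset_side_cases:
  assumes "T \<subseteq> S"
  obtains "T \<subseteq> side False S" | "T \<subseteq> side True S"
    | "T \<inter> side False S \<noteq> {}" "T \<inter> side True S \<noteq> {}"
  using assms sides_cover[of S] by blast

lemma levels_mono: "T \<subseteq> S \<Longrightarrow> levels T \<subseteq> levels S"
  by (auto simp: levels_def)

lemma levelsI: "T \<subseteq> S \<Longrightarrow> 2 \<le> card T \<Longrightarrow> branch T \<in> levels S"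
  by (auto simp: levels_def)

lemma levels_subset: "S \<subseteq> Pow {..<M::nat} \<Longrightarrow> levels S \<subseteq> {..<M}"
proof
  fix x assume S: "S \<subseteq> Pow {..<M}" and "x \<in> levels S"
  then obtain T where T: "T \<subseteq> S" "2 \<le> card T" "x = branch T" by (auto simp: levels_def)
  then have "T \<subseteq> Pow {..<M}" using S by blast
  then show "x \<in> {..<M}" using branch_mem[of T M] T(2,3) by blast
qed

lemma finite_levels: "S \<subseteq> Pow {..<M::nat} \<Longrightarrow> finite (levels S)"
  using finite_subset[OF levels_subset] by blast

lemma levels_trivial: "card S < 2 \<Longrightarrow> finite S \<Longrightarrow> levels S = {}"
  unfolding levels_def by (auto dest: card_mono)

text \<open>A subset with two or more vertices either meets both sides, and then branches at the
  root, or lies within one side.\<close>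

lemma levels_rec:
  assumes "S \<subseteq> Pow {..<M::nat}" "2 \<le> card S"
  shows "levels S = insert (branch S) (levels (side b S) \<union> levels (side (\<not> b) S))"
proof -
  have "levels S = insert (branch S) (levels (side False S) \<union> levels (side True S))"
  proof
    show "levels S \<subseteq> insert (branch S) (levels (side False S) \<union> levels (side True S))"
    proof
      fix x assume "x \<in> levels S"
      then obtain T where T: "T \<subseteq> S" "2 \<le> card T" "x = branch T" by (auto simp: levels_def)
      from T(1) show "x \<in> insert (branch S) (levels (side False S) \<union> levels (side True S))"
        by (cases rule: subset_side_cases)
           (use T levelsI branch_eqI[OF assms(1) T(1)] in auto)
    qed
    show "insert (branch S) (levels (side False S) \<union> levels (side True S)) \<subseteq> levels S"
      using assms(2) levelsI[of S S] levels_mono[OF side_subset[of _ S]] by auto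
  qed
  then show ?thesis by (cases b) auto
qed

lemma levels_side_less:
  assumes "S \<subseteq> Pow {..<M::nat}" "x \<in> levels (side b S)"
  shows "x < branch S"
  using assms branch_less[OF assms(1)] by (auto simp: levels_def)

lemma levels_pair:
  assumes "S \<subseteq> Pow {..<M::nat}" "x \<in> levels S"
  obtains u v where "u \<in> S" "v \<in> S" "u \<noteq> v" "branch {u, v} = x"
proof -
  obtain T where T: "T \<subseteq> S" "2 \<le> card T" "x = branch T"
    using assms(2) by (auto simp: levels_def)
  have TM: "T \<subseteq> Pow {..<M}" using T(1) assms(1) by blast
  obtain u v where uv: "u \<in> side False T" "v \<in> side True T"
    using side_nonempty[OF TM T(2)] by blast
  then have "branch {u, v} = branch T"
    by (intro branch_eqI[OF TM]) (auto simp: side_def)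
  moreover have "u \<noteq> v" using uv by (auto simp: side_def)
  ultimately show ?thesis using that uv T side_subset by blast
qed

section \<open>Combs and their levels\<close>

lemma comb_mono: "comb b S \<Longrightarrow> T \<subseteq> S \<Longrightarrow> comb b T"
  by (auto simp: comb_def)

lemma comb_small: "finite S \<Longrightarrow> card S < 3 \<Longrightarrow> comb b S"
  unfolding comb_def by (auto dest: card_mono)

text \<open>Two vertices on side \<open>b\<close> and one on the other side would form a forbidden
  triple.\<close>

lemma comb_side:
  assumes "S \<subseteq> Pow {..<M::nat}" "comb b S" "2 \<le> card S"
  shows "card (side b S) = 1"
proof (rule ccontr)
  assume "card (side b S) \<noteq> 1"
  then have "2 \<le> card (side b S)" using card_side_pos[OF assms(1,3), of b] by linarith
  then obtain u v where uv: "u \<in> side b S" "v \<in> side b S" "u \<noteq> v"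
    using two_elements by blast
  obtain w where w: "w \<in> side (\<not> b) S" using side_nonempty[OF assms(1,3)] by blast
  have ne: "w \<noteq> u" "w \<noteq> v" using uv w by (auto simp: side_def)
  have sub: "{u, v, w} \<subseteq> S" using uv w by (auto simp: side_def)
  have "side b {u, v, w} = {u, v, w} \<inter> side b S"
    by (rule side_eqI[OF assms(1) sub]; cases b; use uv w in auto)
  also have "\<dots> = {u, v}" using uv w by (auto simp: side_def)
  finally have "card (side b {u, v, w}) = 2" using uv(3) by simp
  moreover have "card {u, v, w} = 3" using ne uv(3) by simp
  ultimately show False using assms(2) sub by (simp add: comb_def)
qed

lemma comb_insert:
  assumes "S \<subseteq> Pow {..<M::nat}" "u \<in> side b S" "A \<subseteq> side (\<not> b) S" "comb b A"
  shows "comb b (insert u A)"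
  unfolding comb_def
proof (intro allI impI)
  fix T assume T: "T \<subseteq> insert u A" "card T = 3"
  show "card (side b T) = 1"
  proof (cases "u \<in> T")
    case False
    then show ?thesis using T assms(4) by (auto simp: comb_def)
  next
    case True
    have "T \<noteq> {u}" using T(2) by auto
    then obtain v where v: "v \<in> T" "v \<in> A" using T(1) True by auto
    have "T \<subseteq> S" using T(1) assms(2,3) side_subset by blast
    then have "side b T = T \<inter> side b S"
      by (rule side_eqI[OF assms(1)]; cases b; use v True assms(2,3) in auto)
    also have "\<dots> = {u}" using T(1) True assms(2,3) by (auto simp: side_def)
    finally show ?thesis by simp
  qed
qed

text \<open>Descending always into the larger side, the smaller sides contribute one vertex each to one of
  two combs.\<close>

lemma heavy_path:
  assumes "S \<subseteq> Pow {..<M::nat}" "S \<noteq> {}" "1 \<le> w"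
    and "\<And>T. T \<subseteq> S \<Longrightarrow> 2 \<le> card T \<Longrightarrow> \<exists>b. card (side b T) \<le> w"
  shows "\<exists>A B. A \<subseteq> S \<and> B \<subseteq> S \<and> comb False A \<and> comb True B \<and> card S \<le> w * (card A + card B)"
  using assms
proof (induction "card S" arbitrary: S rule: less_induct)
  case less
  have fin: "finite S" using finite_vertices less.prems by blast
  show ?case
  proof (cases "card S < 2")
    case True
    then have "card S = 1" using less.prems(2) fin by (simp add: Suc_leI card_gt_0_iff le_antisym)
    then show ?thesis using comb_small[OF fin] less.prems(3) by (intro exI[of _ S]) auto
  next
    case False
    then have S2: "2 \<le> card S" by simp
    obtain b where b: "card (side b S) \<le> w" using less.prems(4)[of S] S2 by auto
    let ?H = "side (\<not> b) S"
    have HS: "?H \<subseteq> S" by (rule side_subset)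
    obtain A where A: "\<forall>c. A c \<subseteq> ?H \<and> comb c (A c)" "card ?H \<le> w * (card (A False) + card (A True))"
    proof -
      obtain A B where "A \<subseteq> ?H" "B \<subseteq> ?H" "comb False A" "comb True B" "card ?H \<le> w * (card A + card B)"
        using less.hyps[OF card_side_less[OF less.prems(1) S2] subset_trans[OF HS less.prems(1)]
            side_nonempty[OF less.prems(1) S2] less.prems(3) less.prems(4)[OF subset_trans[OF _ HS]]]
        by blast
      then show ?thesis by (intro that[of "\<lambda>c. if c then B else A"]) auto
    qed
    obtain u where u: "u \<in> side b S" using side_nonempty[OF less.prems(1) S2] by blast
    \<comment> \<open>One vertex of the small side stands for its at most \<open>w\<close> vertices;
      it extends the comb whose single leaves lie on that side.\<close>
    define B where "B = A(b := insert u (A b))"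
    have "u \<notin> ?H" using u by (auto simp: side_def)
    then have "u \<notin> A b" using A(1) by blast
    moreover have "finite (A b)" using A(1) HS fin finite_subset by meson
    ultimately have cB: "card (B b) = Suc (card (A b))" by (simp add: B_def)
    have "card S = card (side b S) + card ?H" using card_sides[OF fin] by simp
    also have "\<dots> \<le> w + w * (card (A b) + card (A (\<not> b)))"
      using b A(2) by (cases b) (auto simp: add.commute)
    also have "\<dots> = w * (card (B b) + card (B (\<not> b)))"
      unfolding cB by (cases b) (auto simp: B_def algebra_simps)
    finally have "card S \<le> w * (card (B False) + card (B True))"
      by (cases b) (auto simp: add.commute)
    moreover have "B c \<subseteq> S \<and> comb c (B c)" for c
      using A(1) HS u comb_insert[OF less.prems(1) u] side_subset[of b S]
      by (cases "c = b") (auto simp: B_def)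
    ultimately show ?thesis by blast
  qed
qed

text \<open>Every node of a comb owns a leaf on side \<open>b\<close>; \<open>l\<close> maps that
  leaf to the level of its node, and deleting the leaf removes only this level. The bottom leaf
  \<open>w\<close> is left over.\<close>

lemma comb_levels_delete:
  assumes "S \<subseteq> Pow {..<M::nat}" "comb b S" "S \<noteq> {}"
  shows "\<exists>w \<in> S. \<exists>l. inj_on l (S - {w}) \<and> l ` (S - {w}) = levels S
           \<and> (\<forall>v \<in> S - {w}. levels (S - {v}) = levels S - {l v})"
  using assms
proof (induction "card S" arbitrary: S rule: less_induct)
  case less
  have fin: "finite S" using finite_vertices less.prems by blast
  show ?case
  proof (cases "card S < 2")
    case True
    then have "card S = 1" using less.prems(3) fin by (simp add: Suc_leI card_gt_0_iff le_antisym)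
    then obtain w where "S = {w}" by (rule card_1_singletonE)
    moreover then have "levels S = {}" using levels_trivial[of S] by simp
    ultimately show ?thesis by auto
  next
    case False
    then have S2: "2 \<le> card S" by simp
    let ?H = "side (\<not> b) S"
    obtain u where u: "side b S = {u}"
      using comb_side[OF less.prems(1,2) S2] by (rule card_1_singletonE)
    have HS: "?H \<subseteq> S" by (rule side_subset)
    then have HM: "?H \<subseteq> Pow {..<M}" using less.prems(1) by blast
    have S: "S = insert u ?H" "u \<notin> ?H" using side_Un[of b S] side_disjoint[of b S] u by auto
    obtain w l where wl: "w \<in> ?H" "inj_on l (?H - {w})" "l ` (?H - {w}) = levels ?H"
       "\<forall>v \<in> ?H - {w}. levels (?H - {v}) = levels ?H - {l v}"
      using less.hyps[OF card_side_less[OF less.prems(1) S2] HM comb_mono[OF less.prems(2) HS]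
          side_nonempty[OF less.prems(1) S2]] by (elim bexE exE conjE)
    have levu: "levels (side b S) = {}" using u by (simp add: levels_trivial)
    have lev: "levels S = insert (branch S) (levels ?H)"
      using levels_rec[OF less.prems(1) S2, of b] levu by simp
    have nin: "branch S \<notin> levels ?H" using levels_side_less[OF less.prems(1), of _ "\<not> b"] by blast
    define l' where "l' = l(u := branch S)"
    have l'H: "l' v = l v" if "v \<in> ?H" for v using that S(2) by (auto simp: l'_def)
    have Sw: "S - {w} = insert u (?H - {w})" using S wl(1) by blast
    have img: "l' ` (?H - {w}) = levels ?H" using wl(3) l'H by auto
    have "l' ` (S - {w}) = levels S"
      unfolding Sw lev image_insert img by (simp add: l'_def)
    moreover have "inj_on l' (S - {w})"
    proof -
      have "inj_on l' (?H - {w})" using wl(2) l'H by (auto simp: inj_on_def)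
      moreover have "l' u \<notin> l' ` (?H - {w})" using img nin by (simp add: l'_def)
      ultimately show ?thesis unfolding Sw by auto
    qed
    moreover have "levels (S - {v}) = levels S - {l' v}" if v: "v \<in> S - {w}" for v
    proof (cases "v = u")
      case True
      then have "S - {v} = ?H" using S by blast
      then show ?thesis using True lev nin by (simp add: l'_def)
    next
      case False
      then have vH: "v \<in> ?H - {w}" using v S by blast
      let ?T = "S - {v}"
      have TM: "?T \<subseteq> Pow {..<M}" using less.prems(1) by blast
      have "u \<in> ?T" "w \<in> ?T" "u \<noteq> w" using S vH wl(1) by blast+
      then have T2: "2 \<le> card ?T"
        using card_mono[of ?T "{u, w}"] fin by simp
      have meet: "?T \<inter> side False S \<noteq> {}" "?T \<inter> side True S \<noteq> {}"
      proof -
        have "u \<in> ?T \<inter> side b S" "w \<in> ?T \<inter> side (\<not> b) S"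
          using u wl(1) \<open>u \<in> ?T\<close> \<open>w \<in> ?T\<close> by simp_all
        then show "?T \<inter> side False S \<noteq> {}" "?T \<inter> side True S \<noteq> {}"
          by (cases b; force)+
      qed
      have sid: "side c ?T = ?T \<inter> side c S" for c
        by (rule side_eqI[OF less.prems(1) _ meet]) blast
      have "side b ?T = {u}" using sid[of b] u \<open>u \<in> ?T\<close> by auto
      then have "levels (side b ?T) = {}" by (simp add: levels_trivial)
      moreover have "side (\<not> b) ?T = ?H - {v}" using sid[of "\<not> b"] HS by blast
      ultimately have "levels ?T = insert (branch S) (levels (?H - {v}))"
        using levels_rec[OF TM T2, of b] branch_eqI[OF less.prems(1) _ meet] by simp
      also have "\<dots> = insert (branch S) (levels ?H - {l v})" using wl(4) vH by simp
      also have "\<dots> = levels S - {l v}"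
      proof -
        have "l v \<in> levels ?H" using imageI[OF vH, of l] unfolding wl(3) .
        then have "l v \<noteq> branch S" using nin by metis
        then show ?thesis unfolding lev by auto
      qed
      finally show ?thesis using l'H vH by simp
    qed
    ultimately show ?thesis using wl(1) HS by (intro bexI[of _ w] exI[of _ l']) auto
  qed
qed

lemma comb_card_levels:
  assumes "S \<subseteq> Pow {..<M::nat}" "comb b S"
  shows "card (levels S) = card S - 1"
proof (cases "S = {}")
  case False
  then obtain w l where "w \<in> S" "inj_on l (S - {w})" "l ` (S - {w}) = levels S"
    using comb_levels_delete[OF assms] by blast
  then show ?thesis using finite_vertices[OF assms(1)] by (metis card_Diff_singleton card_image)
qed (simp add: levels_trivial)

text \<open>A level outside \<open>D\<close> can be removed alone, by deleting the leaf that owns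
  it, until only \<open>D\<close> remains.\<close>

lemma comb_realize_levels:
  assumes "S \<subseteq> Pow {..<M::nat}" "comb b S" "S \<noteq> {}" "D \<subseteq> levels S"
  shows "\<exists>T \<subseteq> S. levels T = D \<and> card T = card D + 1"
  using assms
proof (induction "card S" arbitrary: S rule: less_induct)
  case less
  have fin: "finite S" using finite_vertices less.prems by blast
  show ?case
  proof (cases "D = levels S")
    case True
    have "card S > 0" using fin less.prems by (simp add: card_gt_0_iff)
    then show ?thesis using True comb_card_levels[OF less.prems(1,2)] by (intro exI[of _ S]) auto
  next
    case False
    then obtain x where x: "x \<in> levels S" "x \<notin> D" using less.prems by blast
    obtain w l where wl: "w \<in> S" "l ` (S - {w}) = levels S"
      "\<forall>v \<in> S - {w}. levels (S - {v}) = levels S - {l v}"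
      using comb_levels_delete[OF less.prems(1,2,3)] by blast
    have "x \<in> l ` (S - {w})" using x(1) wl(2) by simp
    then obtain v where v: "v \<in> S - {w}" "l v = x" by (elim imageE) simp
    have sub: "S - {v} \<subseteq> S" by blast
    have "\<exists>T \<subseteq> S - {v}. levels T = D \<and> card T = card D + 1"
    proof (rule less.hyps)
      show "card (S - {v}) < card S" using v fin by (intro psubset_card_mono) auto
      show "S - {v} \<subseteq> Pow {..<M}" using less.prems(1) by auto
      show "comb b (S - {v})" using comb_mono[OF less.prems(2) sub] .
      show "S - {v} \<noteq> {}" using v(1) wl(1) by auto
      show "D \<subseteq> levels (S - {v})"
        using bspec[OF wl(3) v(1)] v(2) x(2) less.prems(4) by blast
    qed
    then obtain T where "T \<subseteq> S - {v}" "levels T = D \<and> card T = card D + 1" by blast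
    then show ?thesis using sub by (intro exI[of _ T]) auto
  qed
qed

subsection \<open>Stepping up\<close>

text \<open>\<open>R\<close> is the set of red edges; the edges inside a set \<open>S\<close> of \<open>k + 1\<close> vertices are indexed by
  the vertex they miss.\<close>

definition eh_witness :: "'a set \<Rightarrow> ('a set \<Rightarrow> bool) \<Rightarrow> nat \<Rightarrow> nat \<Rightarrow> nat \<Rightarrow> bool" where
  "eh_witness V R k t n \<longleftrightarrow>
     (\<forall>S \<subseteq> V. card S = k + 1 \<longrightarrow> card {v \<in> S. R (S - {v})} < t) \<and>
     (\<forall>S \<subseteq> V. finite S \<longrightarrow> (\<forall>e \<subseteq> S. card e = k \<longrightarrow> \<not> R e) \<longrightarrow> card S < n)"

lemma comb_both_small:
  assumes "finite A" "comb b A" "comb (\<not> b) A"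
  shows "card A < 3"
proof (rule ccontr)
  assume "\<not> card A < 3"
  then obtain T where T: "T \<subseteq> A" "card T = 3" "finite T"
    using obtain_subset_with_card_n[of 3 A] by force
  then have "card (side b T) = 1" "card (side (\<not> b) T) = 1"
    using assms(2,3) by (auto simp: comb_def)
  then show False using card_sides[OF T(3), of b] T(2) by simp
qed

text \<open>As long as \<open>v\<close> is not alone on its side, both sides survive its deletion
  and the root stays.\<close>

lemma side_delete:
  assumes "S \<subseteq> Pow {..<M::nat}" "2 \<le> card S" "\<And>b. side b S \<noteq> {v}"
  shows "side b (S - {v}) = side b S - {v}" "branch (S - {v}) = branch S"
proof -
  have ne: "(S - {v}) \<inter> side c S \<noteq> {}" for c
  proof -
    have "side c S - {v} \<noteq> {}" using side_nonempty[OF assms(1,2), of c] assms(3)[of c] by auto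
    then show ?thesis using side_subset[of c S] by auto
  qed
  show "branch (S - {v}) = branch S" using branch_eqI[OF assms(1) _ ne ne] by simp
  have "side b (S - {v}) = (S - {v}) \<inter> side b S" using side_eqI[OF assms(1) _ ne ne] by simp
  then show "side b (S - {v}) = side b S - {v}" using side_subset[of b S] by auto
qed

text \<open>The additional red trees \<open>Q\<close> must not share \<open>k\<close> vertices with a comb of size \<open>k + 1\<close>, so that the two
  kinds of red edges can be counted separately.\<close>

lemma step_up:
  assumes k: "4 \<le> k" and W: "eh_witness {..<M::nat} \<phi> k (k - 1) n"
    and mix: "\<And>P v b. P \<subseteq> Pow {..<M} \<Longrightarrow> card P = k + 1 \<Longrightarrow> Q P \<Longrightarrow> v \<in> P \<Longrightarrow> \<not> comb b (P - {v})"
    and cnt: "\<And>S. S \<subseteq> Pow {..<M} \<Longrightarrow> card S = k + 2 \<Longrightarrow> card {v \<in> S. Q (S - {v})} < k"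
    and blue: "\<And>S. S \<subseteq> Pow {..<M} \<Longrightarrow> (\<And>e. e \<subseteq> S \<Longrightarrow> card e = k + 1 \<Longrightarrow> \<not> Q e) \<Longrightarrow>
       (\<And>b T. T \<subseteq> S \<Longrightarrow> comb b T \<Longrightarrow> card T \<le> n) \<Longrightarrow> card S < n'"
  shows "eh_witness (Pow {..<M}) (\<lambda>S. Q S \<or> (\<exists>b. comb b S) \<and> \<phi> (levels S)) (k + 1) k n'"
    (is "eh_witness _ ?R _ _ _")
  unfolding eh_witness_def
proof (intro conjI allI impI)
  fix S assume S: "S \<subseteq> Pow {..<M}" and cS: "card S = k + 1 + 1"
  have fin: "finite S" by (rule finite_vertices[OF S])
  have sub: "S - {v} \<subseteq> S" for v by blast
  have subM: "S - {v} \<subseteq> Pow {..<M}" for v using S by blast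
  have cSv: "card (S - {v}) = k + 1" if "v \<in> S" for v using that cS by simp
  show "card {v \<in> S. ?R (S - {v})} < k"
  proof (cases "\<exists>v \<in> S. Q (S - {v})")
    case True
    then obtain v0 where v0: "v0 \<in> S" "Q (S - {v0})" by blast
    have nc: "\<not> comb b (S - {v})" if "v \<in> S" for v b
    proof
      assume c: "comb b (S - {v})"
      have "S - {v0} \<noteq> {}" using cSv[OF v0(1)] by (metis card.empty add_is_0 one_neq_zero)
      then obtain x where x: "x \<in> S - {v0}" by blast
      \<comment> \<open>\<open>v'\<close> makes \<open>S - {v0} - {v'}\<close> a subset of the
        alleged comb \<open>S - {v}\<close>: it is \<open>v\<close> itself, or any other vertex if
        \<open>v\<close> is \<open>v0\<close>.\<close>
      define v' where "v' = (if v = v0 then x else v)"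
      have v': "v' \<in> S - {v0}" using x that by (simp add: v'_def)
      have "S - {v0} - {v'} \<subseteq> S - {v}" by (auto simp: v'_def)
      then have "comb b (S - {v0} - {v'})" by (rule comb_mono[OF c])
      then show False using mix[OF subM cSv[OF v0(1)] v0(2) v'] by simp
    qed
    then have "{v \<in> S. ?R (S - {v})} = {v \<in> S. Q (S - {v})}" by blast
    then show ?thesis using cnt[OF S] cS by simp
  next
    case noQ: False
    show ?thesis
    proof (cases "\<exists>b. comb b S")
      case True
      then obtain b where b: "comb b S" by blast
      have "S \<noteq> {}" using cS by auto
      from comb_levels_delete[OF S b this]
      obtain w l where wl: "w \<in> S" "inj_on l (S - {w})" "l ` (S - {w}) = levels S"
        "\<forall>v \<in> S - {w}. levels (S - {v}) = levels S - {l v}"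
        by (elim bexE exE conjE)
      \<comment> \<open>Deleting a vertex other than \<open>w\<close> deletes one of the
        \<open>k + 1\<close> levels, so \<open>W\<close> allows at most \<open>k - 2\<close> red
        edges here; \<open>w\<close> may add one more.\<close>
      let ?X = "{v \<in> S - {w}. \<phi> (levels S - {l v})}"
      have "{v \<in> S. ?R (S - {v})} \<subseteq> insert w ?X"
      proof
        fix v assume v: "v \<in> {v \<in> S. ?R (S - {v})}"
        then have "\<phi> (levels (S - {v}))" using noQ by blast
        then show "v \<in> insert w ?X" using v wl(4) by (cases "v = w") simp_all
      qed
      then have "card {v \<in> S. ?R (S - {v})} \<le> card (insert w ?X)"
        using fin by (intro card_mono) auto
      also have "\<dots> \<le> Suc (card ?X)" by (rule card_insert_le_m1) auto
      also have "card ?X = card (l ` ?X)"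
        by (rule card_image[symmetric]) (rule inj_on_subset[OF wl(2)], auto)
      also have "l ` ?X \<subseteq> {x \<in> levels S. \<phi> (levels S - {x})}" using wl(3) by auto
      then have "card (l ` ?X) \<le> card {x \<in> levels S. \<phi> (levels S - {x})}"
        using finite_levels[OF S] by (intro card_mono) auto
      also have "card {x \<in> levels S. \<phi> (levels S - {x})} < k - 1"
        using W levels_subset[OF S] comb_card_levels[OF S b] cS unfolding eh_witness_def by simp
      finally show ?thesis using k by simp
    next
      case False
      show ?thesis
      proof (cases "\<exists>v \<in> S. \<exists>b. comb b (S - {v})")
        case no: False
        then have "{v \<in> S. ?R (S - {v})} = {}" using noQ by blast
        then show ?thesis using k by (metis card.empty gr0I not_numeral_le_zero)
      next
        case True
        then obtain v0 b where v0: "v0 \<in> S" "comb b (S - {v0})" by blast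
        \<comment> \<open>\<open>T\<close> shows that \<open>S\<close> is no comb. All combs
          \<open>S - {v}\<close> share at least three vertices with \<open>S - {v0}\<close>, hence
          have the same orientation, so each misses a vertex of \<open>T\<close>; there are at most
          three.\<close>
        obtain T where T: "T \<subseteq> S" "card T = 3" "card (side b T) \<noteq> 1"
          using False by (auto simp: comb_def)
        have "v \<in> T" if v: "v \<in> S" "comb c (S - {v})" for v c
        proof -
          have cc: "comb b (S - {v0} - {v})" "comb c (S - {v0} - {v})"
            by (rule comb_mono[OF v0(2)], blast, rule comb_mono[OF v(2)], blast)
          have "card (S - {v0} - {v}) \<ge> k"
            using cSv[OF v0(1)] card_Diff1_le[of "S - {v0}" v] diff_card_le_card_Diff[of "{v}" "S - {v0}"] by simp
          then have "c = b" using comb_both_small[of "S - {v0} - {v}" b] cc fin k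
            by (cases b; cases c; force)
          then have "\<not> T \<subseteq> S - {v}" using v(2) T(2,3) by (auto simp: comb_def)
          then show "v \<in> T" using T(1) by blast
        qed
        then have "{v \<in> S. ?R (S - {v})} \<subseteq> T" using noQ by blast
        then have "card {v \<in> S. ?R (S - {v})} \<le> card T"
          by (rule card_mono[OF finite_subset[OF T(1) fin]])
        then have "card {v \<in> S. ?R (S - {v})} \<le> 3" unfolding T(2) .
        then show ?thesis using k by linarith
      qed
    qed
  qed
next
  fix S assume S: "S \<subseteq> Pow {..<M}" and fin: "finite S"
    and free: "\<forall>e \<subseteq> S. card e = k + 1 \<longrightarrow> \<not> ?R e"
  show "card S < n'"
  proof (rule blue[OF S])
    show "\<not> Q e" if "e \<subseteq> S" "card e = k + 1" for e using free that by blast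
    fix b T assume T: "T \<subseteq> S" "comb b T"
    have TM: "T \<subseteq> Pow {..<M}" using T(1) S by simp
    show "card T \<le> n"
    proof (rule ccontr)
      assume "\<not> card T \<le> n"
      then have "\<not> card (levels T) < n" "T \<noteq> {}" using comb_card_levels[OF TM T(2)] by auto
      then obtain D where D: "D \<subseteq> levels T" "card D = k" "\<phi> D"
        using W levels_subset[OF TM] finite_levels[OF TM] unfolding eh_witness_def by blast
      obtain e where e: "e \<subseteq> T" "levels e = D \<and> card e = card D + 1"
        using comb_realize_levels[OF TM T(2) \<open>T \<noteq> {}\<close> D(1)] by blast
      have "comb b e" using comb_mono[OF T(2) e(1)] .
      then show False using free e D T(1) by (metis subset_trans)
    qed
  qed
qed

section \<open>Edges of size at least six\<close>

text \<open>Both sides of an additional red tree have at least three leaves, so no deletion makes it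
  a comb. If \<open>k + 2\<close> vertices have three leaves on the left, only the
  \<open>k - 1\<close> deletions on the right give such trees; if four, only the four on the left,
  which is fewer than \<open>k\<close>. If a side is a single leaf, at most one deletion
  does.\<close>

lemma step_up_large:
  assumes k: "5 \<le> k" and W: "eh_witness {..<M::nat} \<phi> k (k - 1) n"
  shows "\<exists>R. eh_witness (Pow {..<M}) R (k + 1) k (2 * k * n + 1)"
proof -
  let ?Q = "\<lambda>S. card (side False S) = 3"
  have "eh_witness (Pow {..<M}) (\<lambda>S. ?Q S \<or> (\<exists>b. comb b S) \<and> \<phi> (levels S)) (k + 1) k (2 * k * n + 1)"
  proof (rule step_up[OF _ W])
    show "4 \<le> k" using k by simp
  next
    fix P v b assume P: "P \<subseteq> Pow {..<M}" "card P = k + 1" "?Q P" "v \<in> P"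
    have fin: "finite P" by (rule finite_vertices[OF P(1)])
    have card3: "card (side c P) \<ge> 3" for c
      using card_sides[OF fin, of False] P(2,3) k by (cases c) auto
    have "side c P \<noteq> {v}" for c using card3[of c] by auto
    then have "side b (P - {v}) = side b P - {v}"
      using side_delete[OF P(1)] P(2) k by simp
    moreover have "card (side b P - {v}) \<ge> 2"
      using card3[of b] diff_card_le_card_Diff[of "{v}" "side b P"] by simp
    moreover have "card (P - {v}) = k" using P by simp
    moreover have "P - {v} \<subseteq> Pow {..<M}" using P(1) by auto
    ultimately show "\<not> comb b (P - {v})" using comb_side[of "P - {v}" M b] k by fastforce
  next
    fix S assume S: "S \<subseteq> Pow {..<M}" and cS: "card S = k + 2"
    have fin: "finite S" by (rule finite_vertices[OF S])
    have S2: "2 \<le> card S" using cS by simp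
    have fins: "finite (side b S)" for b using fin side_subset finite_subset by metis
    let ?X = "{v \<in> S. ?Q (S - {v})}"
    have sum: "card (side False S) + card (side True S) = k + 2" using card_sides[OF fin, of False] cS by simp
    show "card ?X < k"
    proof (cases "\<exists>u b. side b S = {u}")
      case True
      then obtain u b where u: "side b S = {u}" by blast
      have "?X \<subseteq> {u}"
      proof
        fix v assume v: "v \<in> ?X"
        show "v \<in> {u}"
        proof (rule ccontr)
          assume "v \<notin> {u}"
          then have vu: "v \<noteq> u" by simp
          have cn: "card (side (\<not> b) S) = k + 1" using u sum by (cases b) auto
          have "side c S \<noteq> {v}" for c
            using u cn vu k by (cases "c = b"; cases b; cases c; force)
          then have sd: "side False (S - {v}) = side False S - {v}" using side_delete[OF S S2] by simp
          show False
          proof (cases b)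
            case True
            then have "v \<in> side False S" using v u vu side_Un[of True S] by auto
            then have "card (side False S - {v}) = k" using cn True by simp
            then show False using v sd k by simp
          next
            case False
            then show False using v sd u vu by simp
          qed
        qed
      qed
      then have "card ?X \<le> 1" using card_mono[of "{u}"] by fastforce
      then show ?thesis using k by linarith
    next
      case False
      then have sd: "side False (S - {v}) = side False S - {v}" for v using side_delete[OF S S2] by simp
      show ?thesis
      proof (cases "card (side False S) = 3")
        case True
        have "?X \<subseteq> side True S"
        proof
          fix v assume v: "v \<in> ?X"
          have c: "card (side False S - {v}) = 3" using v sd[of v] by simp
          have "v \<notin> side False S"
          proof
            assume "v \<in> side False S"
            then have "card (side False S - {v}) = 2" using True by simp
            then show False using c by simp
          qed
          then show "v \<in> side True S" using v side_Un[of True S] by simp blast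
        qed
        then have "card ?X \<le> card (side True S)" using fins by (intro card_mono)
        then show ?thesis using sum True k by simp
      next
        case ne: False
        have *: "v \<in> side False S \<and> card (side False S) = 4" if v: "v \<in> ?X" for v
        proof -
          have c: "card (side False S - {v}) = 3" using v sd[of v] by simp
          then have "v \<in> side False S" using ne by (metis Diff_empty Diff_insert0)
          then show ?thesis using c fins[of False] by auto
        qed
        then have "?X \<subseteq> side False S" by blast
        then have le: "card ?X \<le> card (side False S)" using fins by (intro card_mono)
        have "?X = {} \<or> card (side False S) = 4" using * by blast
        then show ?thesis
        proof
          assume "?X = {}"
          then have "card ?X = 0" by (simp only: card.empty)
          then show ?thesis using k by linarith
        qed (use le k in linarith)
      qed
    qed
  next
    fix S assume S: "S \<subseteq> Pow {..<M}" and noQ: "\<And>e. e \<subseteq> S \<Longrightarrow> card e = k + 1 \<Longrightarrow> \<not> ?Q e"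
      and combs: "\<And>b T. T \<subseteq> S \<Longrightarrow> comb b T \<Longrightarrow> card T \<le> n"
    show "card S < 2 * k * n + 1"
    proof (cases "S = {}")
      case False
      have "\<exists>b. card (side b T) \<le> k" if T: "T \<subseteq> S" "2 \<le> card T" for T
      proof (rule ccontr)
        assume "\<not> ?thesis"
        then have big: "k \<le> card (side b T)" for b by (meson nle_le)
        have TM: "T \<subseteq> Pow {..<M}" using T(1) S by simp
        obtain X where X: "X \<subseteq> side False T" "card X = 3" "finite X"
          using obtain_subset_with_card_n[of 3 "side False T"] big[of False] k by auto
        obtain Y where Y: "Y \<subseteq> side True T" "card Y = k - 2" "finite Y"
          using obtain_subset_with_card_n[of "k - 2" "side True T"] big[of True] by (metis diff_le_self le_trans)
        have disj: "X \<inter> Y = {}" using X(1) Y(1) sides_cover(2)[of T] by blast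
        have XY: "X \<union> Y \<subseteq> T" using X(1) Y(1) side_subset by blast
        have "X \<noteq> {}" "Y \<noteq> {}" using X Y k by auto
        then have "side False (X \<union> Y) = (X \<union> Y) \<inter> side False T"
          using X(1) Y(1) by (intro side_eqI[OF TM XY]) auto
        also have "\<dots> = X" using X(1) Y(1) sides_cover(2)[of T] by blast
        finally have "?Q (X \<union> Y)" using X by simp
        moreover have "card (X \<union> Y) = k + 1" using card_Un_disjoint[OF X(3) Y(3) disj] X(2) Y(2) k by simp
        ultimately show False using noQ XY T(1) by (metis subset_trans)
      qed
      then obtain A B where AB: "A \<subseteq> S" "B \<subseteq> S" "comb False A" "comb True B" "card S \<le> k * (card A + card B)"
        using heavy_path[OF S False, of k] k by auto
      have "card A + card B \<le> 2 * n" using combs[OF AB(1,3)] combs[OF AB(2,4)] by simp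
      then have "k * (card A + card B) \<le> k * (2 * n)" by (rule mult_le_mono2)
      with AB(5) have "card S \<le> k * (2 * n)" by (rule le_trans)
      then show ?thesis by (simp add: mult.left_commute)
    qed simp
  qed
  then show ?thesis by blast
qed

section \<open>Edges of size four\<close>

lemma side_join:
  assumes "S \<subseteq> Pow {..<M::nat}" "X \<subseteq> side False S" "Y \<subseteq> side True S" "X \<noteq> {}" "Y \<noteq> {}"
  shows "side False (X \<union> Y) = X" "side True (X \<union> Y) = Y" "branch (X \<union> Y) = branch S"
proof -
  have XY: "X \<union> Y \<subseteq> S" using assms(2,3) side_subset by blast
  have ne: "(X \<union> Y) \<inter> side False S \<noteq> {}" "(X \<union> Y) \<inter> side True S \<noteq> {}"
    using assms(2-5) by auto
  show "branch (X \<union> Y) = branch S" by (rule branch_eqI[OF assms(1) XY ne])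
  have "side b (X \<union> Y) = (X \<union> Y) \<inter> side b S" for b by (rule side_eqI[OF assms(1) XY ne])
  then show "side False (X \<union> Y) = X" "side True (X \<union> Y) = Y"
    using assms(2,3) sides_cover(2)[of S] by blast+
qed

lemma triple_sides:
  assumes "T \<subseteq> Pow {..<M::nat}" "card T = 3"
  obtains c w where "side c T = {w}" "card (side (\<not> c) T) = 2"
proof -
  have T2: "2 \<le> card T" using assms(2) by simp
  have "card (side False T) + card (side True T) = 3"
    using card_sides[OF finite_vertices[OF assms(1)], of False] assms(2) by simp
  then have "card (side False T) = 1 \<and> card (side True T) = 2 \<or>
      card (side True T) = 1 \<and> card (side False T) = 2"
    using card_side_pos[OF assms(1) T2, of False] card_side_pos[OF assms(1) T2, of True] by linarith
  then have "\<exists>c. card (side c T) = 1 \<and> card (side (\<not> c) T) = 2" by auto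
  then show ?thesis using that by (metis card_1_singletonE)
qed

lemma side_delete_singleton:
  assumes "S \<subseteq> Pow {..<M::nat}" "3 \<le> card S" "side b S = {u}" "v \<noteq> u"
  shows "side c (S - {v}) = side c S - {v}"
proof (rule side_delete(1)[OF assms(1)])
  show "2 \<le> card S" using assms(2) by simp
  have "card (side (\<not> b) S) \<ge> 2"
    using card_sides[OF finite_vertices[OF assms(1)], of b] assms(2,3) by simp
  then show "side d S \<noteq> {v}" for d using assms(3,4) by (cases "d = b") auto
qed

text \<open>More than one red edge among five vertices requires a split into two and three, and each
  arises by deleting one of the three. These deletions do not all leave the same level, so at most
  two match the level of the pair. In a blue set no level occurs on both sides of a node, so there
  are as many levels as nodes, and at most \<open>p\<close> of them.\<close>

lemma eh_witness_4:
  "eh_witness (Pow {..<p::nat}) (\<lambda>S. card (side False S) = 2 \<and> card (side True S) = 2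
     \<and> branch (side False S) = branch (side True S)) 4 3 (p + 2)"
  (is "eh_witness _ ?R _ _ _")
  unfolding eh_witness_def
proof (intro conjI allI impI)
  fix S :: "nat set set" assume S: "S \<subseteq> Pow {..<p}" and cS: "card S = 4 + 1"
  have fin: "finite S" by (rule finite_vertices[OF S])
  have S2: "2 \<le> card S" using cS by simp
  have fins: "finite (side b S)" for b using fin side_subset finite_subset by metis
  let ?X = "{v \<in> S. ?R (S - {v})}"
  have sum: "card (side b S) + card (side (\<not> b) S) = 5" for b using card_sides[OF fin, of b] cS by simp
  show "card ?X < 3"
  proof (cases "\<exists>u b. side b S = {u}")
    case True
    then obtain u b where u: "side b S = {u}" by blast
    have "?X \<subseteq> {u}"
    proof
      fix v assume v: "v \<in> ?X"
      show "v \<in> {u}"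
      proof (rule ccontr)
        assume vu: "v \<notin> {u}"
        then have "side b (S - {v}) = {u}"
          using side_delete_singleton[OF S _ u] cS u by auto
        then have "card (side b (S - {v})) = 1" by simp
        then show False using v by (cases b) auto
      qed
    qed
    then have "card ?X \<le> 1" using card_mono[of "{u}"] by fastforce
    then show ?thesis by linarith
  next
    case False
    then have sd: "side c (S - {v}) = side c S - {v}" for v c using side_delete[OF S S2] by simp
    have ge2: "card (side b S) \<ge> 2" for b
    proof -
      have "card (side b S) \<noteq> 1" using False by (metis card_1_singletonE)
      then show ?thesis using card_side_pos[OF S S2, of b] by linarith
    qed
    have "card (side False S) = 2 \<or> card (side True S) = 2"
      using sum[of False] ge2[of False] ge2[of True] by simp linarith
    then obtain b where b2: "card (side b S) = 2" by blast
    let ?T = "side (\<not> b) S"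
    have T3: "card ?T = 3" using sum[of b] b2 by simp
    have TM: "?T \<subseteq> Pow {..<p}" using S side_subset by blast
    have red: "v \<in> ?T \<and> branch (?T - {v}) = branch (side b S)" if v: "v \<in> ?X" for v
    proof -
      have "card (side b S - {v}) = 2" "branch (side b S - {v}) = branch (?T - {v})"
        using v sd[of b v] sd[of "\<not> b" v] by (cases b; simp)+
      moreover then have "v \<notin> side b S" using b2 by auto
      moreover then have "v \<in> ?T" using v side_Un[of b S] by blast
      ultimately show ?thesis by simp
    qed
    \<comment> \<open>\<open>w\<close> is alone on its side of the triple: deleting it leaves a
      lower level, deleting \<open>v\<close> leaves the root level.\<close>
    obtain c w where cw: "side c ?T = {w}" "card (side (\<not> c) ?T) = 2"
      by (rule triple_sides[OF TM T3])
    obtain v where v: "v \<in> side (\<not> c) ?T" using cw(2) by fastforce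
    have "v \<noteq> w" using v cw(1) side_disjoint[of c ?T] by blast
    have T2: "2 \<le> card ?T" using T3 by simp
    have "side d ?T \<noteq> {v}" for d using \<open>v \<noteq> w\<close> cw by (cases "d = c") auto
    then have bv: "branch (?T - {v}) = branch ?T" using side_delete(2)[OF TM T2] by blast
    have "w \<in> ?T" "?T - {w} = side (\<not> c) ?T"
      using cw(1) side_Un[of c ?T] side_disjoint[of c ?T] by auto
    then have bw: "branch (?T - {w}) < branch ?T"
      using branch_less[OF TM, of "side (\<not> c) ?T" "\<not> c"] cw(2) by simp
    have "\<not> (v \<in> ?X \<and> w \<in> ?X)" using red[of v] red[of w] bv bw by force
    moreover have "v \<in> ?T" using v side_subset by blast
    ultimately have "?X \<subset> ?T" using red \<open>w \<in> ?T\<close> by blast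
    then have "card ?X < card ?T" using fins psubset_card_mono by blast
    then show ?thesis using T3 by simp
  qed
next
  fix S assume S: "S \<subseteq> Pow {..<p}" and "\<forall>e \<subseteq> S. card e = 4 \<longrightarrow> \<not> ?R e"
  then have "card S \<le> card (levels S) + 1"
  proof (induction "card S" arbitrary: S rule: less_induct)
    case less
    have fin: "finite S" using finite_vertices[OF less.prems(1)] .
    show ?case
    proof (cases "card S < 2")
      case False
      then have S2: "2 \<le> card S" by simp
      have le: "card (side b S) \<le> card (levels (side b S)) + 1" for b
        using less.hyps[OF card_side_less[OF less.prems(1) S2], of b] side_subset[of b S] less.prems
        by (meson subset_trans)
      have sM: "side b S \<subseteq> Pow {..<p}" for b using less.prems(1) side_subset by blast
      have "levels (side False S) \<inter> levels (side True S) = {}"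
      proof (rule ccontr)
        assume "\<not> ?thesis"
        then obtain x where x: "x \<in> levels (side False S)" "x \<in> levels (side True S)" by blast
        obtain u v where uv: "u \<in> side False S" "v \<in> side False S" "u \<noteq> v" "branch {u, v} = x"
          using levels_pair[OF sM x(1)] by metis
        obtain u' v' where uv': "u' \<in> side True S" "v' \<in> side True S" "u' \<noteq> v'" "branch {u', v'} = x"
          using levels_pair[OF sM x(2)] by metis
        let ?e = "{u, v} \<union> {u', v'}"
        have "side False ?e = {u, v}" "side True ?e = {u', v'}"
          using uv uv' by (intro side_join[OF less.prems(1)]; simp)+
        then have "?R ?e" using uv uv' by simp
        moreover have "?e \<subseteq> S" using uv uv' side_subset by blast
        moreover have "card ?e = 4"
        proof -
          have "{u, v} \<inter> {u', v'} = {}" using uv uv' sides_cover(2)[of S] by auto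
          then show ?thesis using uv(3) uv'(3) by (subst card_Un_disjoint) auto
        qed
        ultimately show False using less.prems(2) by blast
      qed
      then have "card (levels (side False S) \<union> levels (side True S))
          = card (levels (side False S)) + card (levels (side True S))"
        using finite_levels[OF sM] by (intro card_Un_disjoint) auto
      moreover have "branch S \<notin> levels (side False S) \<union> levels (side True S)"
        using levels_side_less[OF less.prems(1)] by blast
      ultimately have "card (levels S) = 1 + card (levels (side False S)) + card (levels (side True S))"
        using levels_rec[OF less.prems(1) S2, of False] finite_levels[OF sM] by simp
      then show ?thesis using le[of False] le[of True] card_sides[OF fin, of False] by simp
    qed simp
  qed
  moreover have "card (levels S) \<le> p"
    using card_mono[OF _ levels_subset[OF S]] by simp
  ultimately show "card S < p + 2" by simp
qed

subsection \<open>Edges of size five\<close>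

text \<open>Counting: for fixed \<open>A\<close>, \<open>B\<close> and fixed row values \<open>C \<subseteq> A\<close>, all \<open>s\<^sup>2\<close> pairs between \<open>A\<close> and
  \<open>B\<close> are determined.\<close>

lemma random_tournament:
  assumes M: "M \<le> 2 ^ p" and s: "s = 2 * p + 2"
  shows "\<exists>h :: nat \<Rightarrow> nat \<Rightarrow> bool. (\<forall>x. \<not> h x x) \<and> (\<forall>x y. x < y \<longrightarrow> h x y \<noteq> h y x) \<and>
     (\<forall>A B. A \<subseteq> {..<M} \<longrightarrow> B \<subseteq> {..<M} \<longrightarrow> A \<inter> B = {} \<longrightarrow> card A = s \<longrightarrow> card B = s \<longrightarrow>
       \<not> (\<forall>z \<in> A. \<forall>x \<in> B. \<forall>y \<in> B. h z x = h z y))"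
proof -
  define D where "D = {e. e \<subseteq> {..<M} \<and> card e = 2}"
  define Sub where "Sub = {A. A \<subseteq> {..<M} \<and> card A = s}"
  \<comment> \<open>A graph \<open>E\<close> encodes a tournament: membership of
    \<open>{z, x}\<close> in \<open>E\<close> flips the default direction, which is by size.
    \<open>Bad (A, B, C)\<close> collects those in which the row of each \<open>z\<close> in
    \<open>A\<close> is constant on \<open>B\<close>, with \<open>C\<close> listing the rows that
    are true.\<close>
  define Bad where "Bad = (\<lambda>(A, B, C). {E \<in> Pow D. A \<inter> B = {} \<and>
      (\<forall>z \<in> A. \<forall>x \<in> B. ({z, x} \<in> E) = ((z \<in> C) \<noteq> (z < x)))})"
  define I where "I = (SIGMA A:Sub. Sub \<times> Pow A)"
  have finD: "finite D" unfolding D_def by simp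
  have finSub: "finite Sub" unfolding Sub_def by simp
  have cSub: "card Sub \<le> 2 ^ (p * s)"
  proof -
    have "card Sub = M choose s" using n_subsets[of "{..<M}" s] by (simp add: Sub_def)
    also have "\<dots> \<le> M ^ s"
    proof (cases "s \<le> M")
      case False
      then show ?thesis by (simp add: binomial_eq_0)
    qed (rule binomial_le_pow)
    also have "\<dots> \<le> (2 ^ p) ^ s" using M by (rule power_mono) simp
    finally show ?thesis by (simp add: power_mult)
  qed
  have finA: "finite A \<and> card A = s" if "A \<in> Sub" for A
    using that finite_subset[of A "{..<M}"] by (auto simp: Sub_def)
  have finI: "finite I" unfolding I_def using finSub finA by auto
  have cI: "card I = card Sub * (card Sub * 2 ^ s)"
  proof -
    have "card I = (\<Sum>A\<in>Sub. card (Sub \<times> Pow A))"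
      unfolding I_def using finSub finA by (intro card_SigmaI) auto
    also have "\<dots> = (\<Sum>A\<in>Sub. card Sub * 2 ^ s)"
      using finA by (intro sum.cong) (auto simp: card_cartesian_product card_Pow)
    finally show ?thesis by simp
  qed
  have cBad: "card (Bad q) * 2 ^ (s * s) \<le> 2 ^ card D" if q: "q \<in> I" for q
  proof -
    obtain A B C where qe: "q = (A, B, C)" "A \<in> Sub" "B \<in> Sub" "C \<subseteq> A"
      using q by (auto simp: I_def)
    show ?thesis
    proof (cases "A \<inter> B = {}")
      case False
      then show ?thesis by (simp add: Bad_def qe)
    next
      case True
      define K where "K = (\<lambda>(z, x). {z, x}) ` (A \<times> B)"
      have "inj_on (\<lambda>(z, x). {z, x}) (A \<times> B)"
        using True by (auto simp: inj_on_def doubleton_eq_iff)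
      then have cK: "card K = s * s"
        unfolding K_def using finA qe(2,3) by (simp add: card_image card_cartesian_product)
      have KD: "K \<subseteq> D"
      proof
        fix e assume "e \<in> K"
        then obtain z x where zx: "z \<in> A" "x \<in> B" "e = {z, x}" by (auto simp: K_def)
        then have "z \<noteq> x" using True by blast
        then show "e \<in> D" using zx qe(2,3) by (auto simp: D_def Sub_def)
      qed
      \<comment> \<open>On the pairs in \<open>K\<close> a bad graph is prescribed by
        \<open>A\<close>, \<open>B\<close> and \<open>C\<close>, so its remaining pairs determine
        it.\<close>
      have "inj_on (\<lambda>E. E - K) (Bad q)"
      proof (rule inj_onI)
        fix E F assume E: "E \<in> Bad q" and F: "F \<in> Bad q" and eq: "E - K = F - K"
        have "e \<in> E \<longleftrightarrow> e \<in> F" if "e \<in> K" for e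
          using that E F by (auto simp: K_def Bad_def qe)
        then show "E = F" using eq by blast
      qed
      moreover have "(\<lambda>E. E - K) ` Bad q \<subseteq> Pow (D - K)" by (auto simp: Bad_def qe)
      ultimately have "card (Bad q) \<le> card (Pow (D - K))"
        using finD by (intro card_inj_on_le) auto
      also have "\<dots> = 2 ^ (card D - s * s)"
        using finD KD cK finite_subset[OF KD finD] by (simp add: card_Pow card_Diff_subset)
      finally have "card (Bad q) * 2 ^ (s * s) \<le> 2 ^ (card D - s * s) * 2 ^ (s * s)" by simp
      also have "\<dots> = 2 ^ card D"
        using card_mono[OF finD KD] cK by (simp flip: power_add)
      finally show ?thesis .
    qed
  qed
  have "card (\<Union>q\<in>I. Bad q) * 2 ^ (s * s) \<le> (\<Sum>q\<in>I. card (Bad q)) * 2 ^ (s * s)"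
    using card_UN_le[OF finI, of Bad] by simp
  also have "\<dots> = (\<Sum>q\<in>I. card (Bad q) * 2 ^ (s * s))" by (rule sum_distrib_right)
  also have "\<dots> \<le> (\<Sum>q\<in>I. 2 ^ card D)" by (rule sum_mono) (rule cBad)
  also have "\<dots> = card Sub * (card Sub * 2 ^ s) * 2 ^ card D" using cI by simp
  also have "\<dots> \<le> 2 ^ (p * s) * (2 ^ (p * s) * 2 ^ s) * 2 ^ card D"
    using cSub by (intro mult_le_mono) auto
  also have "\<dots> = 2 ^ (p * s + (p * s + s)) * 2 ^ card D" by (simp add: power_add)
  \<comment> \<open>The exponent so far is \<open>(2 * p + 1) * s\<close>; this dictates the choice
    of \<open>s\<close>.\<close>
  also have "\<dots> < 2 ^ (s * s) * 2 ^ card D"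
    using s by (intro mult_strict_right_mono power_strict_increasing) auto
  finally have "card (\<Union>q\<in>I. Bad q) < card (Pow D)" using finD by (simp add: card_Pow)
  moreover have "finite (\<Union>q\<in>I. Bad q)"
  proof (rule finite_UN_I[OF finI])
    show "finite (Bad q)" for q
      using finD by (cases q) (auto intro: finite_subset[of _ "Pow D"] simp: Bad_def)
  qed
  ultimately have "\<not> Pow D \<subseteq> (\<Union>q\<in>I. Bad q)"
    using card_mono by (metis not_less)
  then obtain E where E: "E \<in> Pow D" "\<And>q. q \<in> I \<Longrightarrow> E \<notin> Bad q" by blast
  define h where "h x y \<longleftrightarrow> x \<noteq> y \<and> ({x, y} \<in> E) \<noteq> (x < y)" for x y :: nat
  have "\<not> (\<forall>z \<in> A. \<forall>x \<in> B. \<forall>y \<in> B. h z x = h z y)"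
    if AB: "A \<subseteq> {..<M}" "B \<subseteq> {..<M}" "A \<inter> B = {}" "card A = s" "card B = s" for A B
  proof
    assume rows: "\<forall>z \<in> A. \<forall>x \<in> B. \<forall>y \<in> B. h z x = h z y"
    have "B \<noteq> {}" using AB(5) s by auto
    then obtain x0 where x0: "x0 \<in> B" by blast
    define C where "C = {z \<in> A. h z x0}"
    have "(A, B, C) \<in> I" using AB by (auto simp: I_def Sub_def C_def)
    moreover have "({z, x} \<in> E) = ((z \<in> C) \<noteq> (z < x))" if "z \<in> A" "x \<in> B" for z x
    proof -
      have "z \<noteq> x" using that AB(3) by blast
      moreover have "h z x = h z x0" using rows that x0 by blast
      then have "z \<in> C \<longleftrightarrow> h z x" using that(1) by (simp add: C_def)
      ultimately show ?thesis by (auto simp: h_def)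
    qed
    then have "E \<in> Bad (A, B, C)" using E(1) AB(3) by (simp add: Bad_def)
    ultimately show False using E(2) by blast
  qed
  moreover have "\<not> h x x" for x by (simp add: h_def)
  moreover have "h x y \<noteq> h y x" if "x < y" for x y using that by (auto simp: h_def insert_commute)
  ultimately show ?thesis by (intro exI[of _ h]) blast
qed

section \<open>Forks as red trees, and sets without forks\<close>

definition fork :: "(nat \<Rightarrow> nat \<Rightarrow> bool) \<Rightarrow> nat set set \<Rightarrow> bool" where
  "fork h P \<longleftrightarrow> card (side False P) = 2 \<and> card (side True P) = 3 \<and> card (side False (side True P)) = 2 \<and>
     h (branch (side False P)) (branch (side False (side True P))) \<noteq> h (branch (side False P)) (branch (side True P))"

text \<open>Without forks a level may still occur at many nodes, but a pair of a level in a left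
  subtree and the level of its root cannot occur on both sides of a node. There are at most as many
  pairs as the square of the number of levels.\<close>

definition ladders :: "nat set set \<Rightarrow> (nat \<times> nat) set" where
  "ladders S = {(x, branch R) |x R. R \<subseteq> S \<and> 2 \<le> card R \<and> x \<in> levels (side False R)}"

lemma ladders_mono: "T \<subseteq> S \<Longrightarrow> ladders T \<subseteq> ladders S"
  by (fastforce simp: ladders_def)

lemma ladders_subset: "ladders S \<subseteq> levels S \<times> levels S"
proof
  fix q assume "q \<in> ladders S"
  then obtain x R where R: "q = (x, branch R)" "R \<subseteq> S" "2 \<le> card R" "x \<in> levels (side False R)"
    by (auto simp: ladders_def)
  have "levels (side False R) \<subseteq> levels S"
    using levels_mono[OF subset_trans[OF side_subset R(2)]] .
  then show "q \<in> levels S \<times> levels S" using R levelsI[OF R(2,3)] by auto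
qed

lemma ladders_side_less:
  assumes "S \<subseteq> Pow {..<M::nat}" "q \<in> ladders (side b S)"
  shows "snd q < branch S"
  using ladders_subset assms(2) levels_side_less[OF assms(1)] by force

text \<open>Induction at the root: the levels on the left are paid for by their new pairs with the
  root, the levels on the right and the root by the levels of \<open>S\<close>; the pairs from the
  two sides are disjoint by hypothesis.\<close>

lemma card_blue_le_levels:
  assumes "S \<subseteq> Pow {..<M::nat}" and "S \<noteq> {}"
    and "\<And>T. T \<subseteq> S \<Longrightarrow> 2 \<le> card T \<Longrightarrow> ladders (side False T) \<inter> ladders (side True T) = {}"
  shows "card S \<le> 1 + card (levels S) + card (ladders S)"
  using assms
proof (induction "card S" arbitrary: S rule: less_induct)
  case less
  have fin: "finite S" using finite_vertices[OF less.prems(1)] .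
  show ?case
  proof (cases "card S < 2")
    case False
    then have S2: "2 \<le> card S" by simp
    let ?L = "side False S" and ?H = "side True S"
    have sM: "side b S \<subseteq> Pow {..<M}" for b using less.prems(1) side_subset by blast
    have le: "card (side b S) \<le> 1 + card (levels (side b S)) + card (ladders (side b S))" for b
      using less.hyps[OF card_side_less[OF less.prems(1) S2] sM side_nonempty[OF less.prems(1) S2]
          less.prems(3)[OF subset_trans[OF _ side_subset]]] .
    have finl: "finite (ladders (side b S))" for b
      using finite_subset[OF ladders_subset] finite_levels[OF sM] by simp
    have finS: "finite (ladders S)"
      using finite_subset[OF ladders_subset] finite_levels[OF less.prems(1)] by simp
    let ?N = "levels ?L \<times> {branch S}"
    have "?N \<inter> (ladders ?L \<union> ladders ?H) = {}"
      using ladders_side_less[OF less.prems(1)] by fastforce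
    then have "card (?N \<union> (ladders ?L \<union> ladders ?H)) = card ?N + card (ladders ?L \<union> ladders ?H)"
      using finl finite_levels[OF sM] by (intro card_Un_disjoint) auto
    also have "card (ladders ?L \<union> ladders ?H) = card (ladders ?L) + card (ladders ?H)"
      using finl less.prems(3)[of S] S2 by (intro card_Un_disjoint) auto
    also have "card ?N = card (levels ?L)" by (simp add: card_cartesian_product)
    finally have "card (levels ?L) + (card (ladders ?L) + card (ladders ?H))
        = card (?N \<union> (ladders ?L \<union> ladders ?H))" by simp
    also have "\<dots> \<le> card (ladders S)"
    proof (rule card_mono[OF finS])
      have "?N \<subseteq> ladders S" using S2 by (auto simp: ladders_def)
      then show "?N \<union> (ladders ?L \<union> ladders ?H) \<subseteq> ladders S"
        using ladders_mono[OF side_subset, of _ S] by blast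
    qed
    finally have lad: "card (levels ?L) + (card (ladders ?L) + card (ladders ?H)) \<le> card (ladders S)" .
    have "card (insert (branch S) (levels ?H)) \<le> card (levels S)"
      using levels_rec[OF less.prems(1) S2, of False] finite_levels[OF less.prems(1)]
      by (intro card_mono) auto
    moreover have "branch S \<notin> levels ?H" using levels_side_less[OF less.prems(1)] by blast
    ultimately have "1 + card (levels ?H) \<le> card (levels S)" using finite_levels[OF sM] by simp
    then show ?thesis using lad le[of False] le[of True] card_sides[OF fin, of False] by simp
  qed simp
qed

text \<open>On a comb with levels \<open>x < y < z\<close> all four triples would require \<open>f\<close> to take three different
  values on \<open>x\<close>, \<open>y\<close>, \<open>z\<close>.\<close>

lemma quad_cut:
  fixes f :: "nat \<Rightarrow> bool"
  assumes S: "S \<subseteq> Pow {..<M::nat}" "card S = 4"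
  shows "\<not> (\<forall>v \<in> S. card (side False (S - {v})) = 2
                \<and> f (branch (side False (S - {v}))) \<noteq> f (branch (S - {v})))"
proof
  assume all: "\<forall>v \<in> S. card (side False (S - {v})) = 2
                \<and> f (branch (side False (S - {v}))) \<noteq> f (branch (S - {v}))"
  have S2: "2 \<le> card S" using S by simp
  have fin: "finite S" by (rule finite_vertices[OF S(1)])
  let ?L = "side False S"
  have sum: "card ?L + card (side True S) = 4" using card_sides[OF fin, of False] S by simp
  have LM: "?L \<subseteq> Pow {..<M}" using S side_subset by blast
  consider "card ?L = 1" | "card ?L = 2" | "card ?L = 3"
    using sum card_side_pos[OF S(1) S2, of True] card_side_pos[OF S(1) S2, of False] by linarith
  then show False
  proof cases
    case 1
    then obtain u where u: "?L = {u}" by (rule card_1_singletonE)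
    obtain v where v: "v \<in> side True S" using side_nonempty[OF S(1) S2] by blast
    then have "v \<noteq> u" "v \<in> S" using u sides_cover[of S] by auto
    then have "side False (S - {v}) = {u}"
      using side_delete_singleton[OF S(1) _ u] u S by auto
    then show False using all \<open>v \<in> S\<close> by force
  next
    case 2
    obtain v where v: "v \<in> ?L" using side_nonempty[OF S(1) S2] by blast
    have "card (side b S) = 2" for b using 2 sum by (cases b) auto
    then have "side b S \<noteq> {v}" for b by (metis card_1_singleton_iff One_nat_def numeral_eq_one_iff semiring_norm(85))
    then have "side False (S - {v}) = ?L - {v}" using side_delete[OF S(1) S2] by simp
    then have "card (side False (S - {v})) = 1" using v 2 by simp
    moreover have "v \<in> S" using v side_subset by blast
    ultimately show False using all by force
  next
    \<comment> \<open>The levels \<open>x < y < z\<close> are those of \<open>side False ?L\<close>,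
      \<open>?L\<close> and \<open>S\<close>. Deleting \<open>e\<close>, \<open>d\<close> and a leaf
      of the lowest pair separates \<open>f x\<close> from \<open>f y\<close>, \<open>f x\<close>
      from \<open>f z\<close>, and \<open>f y\<close> from \<open>f z\<close>.\<close>
    case 3
    then have "card (side True S) = 1" using sum by simp
    then obtain e where e: "side True S = {e}" by (rule card_1_singletonE)
    have eS: "e \<in> S" "S - {e} = ?L" using e sides_cover[of S] by auto
    have L2: "2 \<le> card ?L" using 3 by simp
    have cl: "card (side False ?L) = 2" "f (branch (side False ?L)) \<noteq> f (branch ?L)"
      using all eS by auto
    then have "card (side True ?L) = 1"
      using card_sides[OF finite_vertices[OF LM], of False] 3 by simp
    then obtain d where d: "side True ?L = {d}" by (rule card_1_singletonE)
    have D: "f (branch (?L - {v})) \<noteq> f (branch S)" if v: "v \<in> ?L" for v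
    proof -
      have "v \<noteq> e" using v e sides_cover(2)[of S] by auto
      then have "side b S \<noteq> {v}" for b using e L2 by (cases b) auto
      then have "side False (S - {v}) = ?L - {v}" "branch (S - {v}) = branch S"
        using side_delete[OF S(1) S2] by simp_all
      moreover have "v \<in> S" using v side_subset by blast
      ultimately show ?thesis using all by metis
    qed
    have "d \<in> ?L" "?L - {d} = side False ?L" using d sides_cover[of ?L] by auto
    then have 1: "f (branch (side False ?L)) \<noteq> f (branch S)" using D[of d] by simp
    obtain v where v: "v \<in> side False ?L" using side_nonempty[OF LM L2] by blast
    then have "v \<noteq> d" using d sides_cover(2)[of ?L] by auto
    then have "side b ?L \<noteq> {v}" for b using d cl(1) by (cases b) auto
    then have "branch (?L - {v}) = branch ?L" using side_delete[OF LM L2] by simp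
    moreover have "v \<in> ?L" using v side_subset by blast
    ultimately have "f (branch ?L) \<noteq> f (branch S)" using D[of v] by simp
    then show False using 1 cl(2) by blast
  qed
qed

text \<open>Absence of forks makes rows of \<open>h\<close> constant, which the tournament tolerates
  only for few levels, and few levels mean at most \<open>1 + s + s\<^sup>2\<close> vertices. The
  two factors \<open>2 * n\<close> come from nested uses of \<open>heavy_path\<close>.\<close>

lemma step_up_5:
  assumes W: "eh_witness {..<M::nat} \<phi> 4 3 n"
    and irr: "\<And>x. \<not> h x x" and tour: "\<And>x y. x < y \<Longrightarrow> h x y \<noteq> h y x"
    and mixed: "\<And>A B. A \<subseteq> {..<M} \<Longrightarrow> B \<subseteq> {..<M} \<Longrightarrow> A \<inter> B = {} \<Longrightarrow> card A = s \<Longrightarrow> card B = s \<Longrightarrow>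
       \<not> (\<forall>z \<in> A. \<forall>x \<in> B. \<forall>y \<in> B. h z x = h z y)"
  shows "\<exists>R. eh_witness (Pow {..<M}) R 5 4 (4 * (1 + s + s\<^sup>2) * n\<^sup>2 + 1)"
proof -
  have "eh_witness (Pow {..<M}) (\<lambda>S. fork h S \<or> (\<exists>b. comb b S) \<and> \<phi> (levels S)) (4 + 1) 4
     (4 * (1 + s + s\<^sup>2) * n\<^sup>2 + 1)"
  proof (rule step_up)
    show "(4::nat) \<le> 4" "eh_witness {..<M} \<phi> 4 (4 - 1) n" using W by simp_all
  next
    fix P v b assume P: "P \<subseteq> Pow {..<M}" "card P = 4 + 1" "fork h P" "v \<in> P"
    have fin: "finite P" by (rule finite_vertices[OF P(1)])
    have c: "card (side False P) = 2" "card (side True P) = 3" "card (side False (side True P)) = 2"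
      using P(3) by (auto simp: fork_def)
    have "side c P \<noteq> {v}" for c using c by (cases c) auto
    then have sd: "side c (P - {v}) = side c P - {v}" for c
      using side_delete[OF P(1)] P(2) by simp
    have PM: "P - {v} \<subseteq> Pow {..<M}" using P(1) by auto
    have cPv: "2 \<le> card (P - {v})" using P(2,4) by simp
    show "\<not> comb b (P - {v})"
    proof
      assume cb: "comb b (P - {v})"
      then have one: "card (side b P - {v}) = 1" using comb_side[OF PM _ cPv] sd by metis
      have "v \<in> side b P"
      proof (rule ccontr)
        assume "v \<notin> side b P"
        then have "side b P - {v} = side b P" by simp
        then show False using one c by (cases b) simp_all
      qed
      \<comment> \<open>A single leaf can only remain on the left, so the comb has orientation
        \<open>False\<close>; but the triple on the right has two leaves left of its root.\<close>
      then have b: "\<not> b" using one c by (cases b) auto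
      have "side True P \<subseteq> P - {v}" using \<open>v \<in> side b P\<close> b sides_cover[of P] by auto
      then have "comb False (side True P)" using comb_mono cb b by auto
      moreover have "side True P \<subseteq> Pow {..<M}" using P(1) side_subset by blast
      ultimately show False using comb_side[of "side True P" M False] c by simp
    qed
  next
    fix S assume S: "S \<subseteq> Pow {..<M}" and cS: "card S = 4 + 2"
    have fin: "finite S" by (rule finite_vertices[OF S])
    have S2: "2 \<le> card S" using cS by simp
    have fins: "finite (side b S)" for b using fin side_subset finite_subset by metis
    let ?X = "{v \<in> S. fork h (S - {v})}"
    have sum: "card (side False S) + card (side True S) = 6" using card_sides[OF fin, of False] cS by simp
    show "card ?X < 4"
    proof (cases "\<exists>u b. side b S = {u}")
      case True
      then obtain u b where u: "side b S = {u}" by blast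
      have "?X \<subseteq> {u}"
      proof
        fix v assume v: "v \<in> ?X"
        show "v \<in> {u}"
        proof (rule ccontr)
          assume vu: "v \<notin> {u}"
          then have "side b (S - {v}) = {u}"
            using side_delete_singleton[OF S _ u] cS u by auto
          then have "card (side b (S - {v})) = 1" by simp
          then show False using v by (cases b) (auto simp: fork_def)
        qed
      qed
      then have "card ?X \<le> 1" using card_mono[of "{u}"] by fastforce
      then show ?thesis by linarith
    next
      case False
      then have sd: "side c (S - {v}) = side c S - {v}" for v c using side_delete[OF S S2] by simp
      have X: "card (side False S - {v}) = 2" "card (side True S - {v}) = 3" if "v \<in> ?X" for v
        using that sd[of False v] sd[of True v] by (auto simp: fork_def)
      show ?thesis
      proof (cases "card (side False S) = 2")
        case True
        let ?T = "side True S"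
        have TM: "?T \<subseteq> Pow {..<M}" using S side_subset by blast
        have T4: "card ?T = 4" using sum True by simp
        have XT: "?X \<subseteq> ?T"
        proof
          fix v assume v: "v \<in> ?X"
          then have "v \<notin> side False S" using X(1)[OF v] True by auto
          then show "v \<in> ?T" using v sides_cover(1)[of S] by blast
        qed
        \<comment> \<open>With two leaves on the left and four on the right, only deletions on the
          right count, and \<open>quad_cut\<close> for the row of the left pair excludes that all
          four do.\<close>
        let ?f = "h (branch (side False S))"
        have red: "card (side False (?T - {v})) = 2 \<and> ?f (branch (side False (?T - {v}))) \<noteq> ?f (branch (?T - {v}))"
          if v: "v \<in> ?X" for v
        proof -
          have "v \<notin> side False S" using v XT sides_cover(2)[of S] by blast
          then show ?thesis using v sd[of False v] sd[of True v] by (simp add: fork_def)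
        qed
        have "?X \<noteq> ?T"
        proof
          assume eq: "?X = ?T"
          show False using quad_cut[OF TM T4, of ?f] red unfolding eq by blast
        qed
        then have "?X \<subset> ?T" using XT by blast
        then have "card ?X < card ?T" using fins psubset_card_mono by blast
        then show ?thesis using T4 by simp
      next
        case ne: False
        have *: "v \<in> side False S \<and> card (side False S) = 3" if v: "v \<in> ?X" for v
        proof -
          have "v \<in> side False S" using X(1)[OF v] ne by (metis Diff_empty Diff_insert0)
          then show ?thesis using X(1)[OF v] fins[of False] by auto
        qed
        then have "?X \<subseteq> side False S" by blast
        then have le: "card ?X \<le> card (side False S)" using fins by (intro card_mono)
        have "?X = {} \<or> card (side False S) = 3" using * by blast
        then show ?thesis
        proof
          assume "?X = {}"
          then have "card ?X = 0" by (simp only: card.empty)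
          then show ?thesis by linarith
        qed (use le in linarith)
      qed
    qed
  next
    fix S assume S: "S \<subseteq> Pow {..<M}" and noQ: "\<And>e. e \<subseteq> S \<Longrightarrow> card e = 4 + 1 \<Longrightarrow> \<not> fork h e"
      and combs: "\<And>b T. T \<subseteq> S \<Longrightarrow> comb b T \<Longrightarrow> card T \<le> n"
    let ?w = "1 + s + s\<^sup>2"
    have SM: "T \<subseteq> Pow {..<M}" if "T \<subseteq> S" for T using that S by simp
    \<comment> \<open>Otherwise a pair branching at \<open>z\<close> left of \<open>T\<close>, a
      pair branching at \<open>x\<close> left of \<open>R\<close> and any leaf on the right of
      \<open>R\<close> form a fork.\<close>
    have row: "h z x = h z (branch R)"
      if T: "T \<subseteq> S" and R: "R \<subseteq> side True T" "2 \<le> card R"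
        and z: "z \<in> levels (side False T)" and x: "x \<in> levels (side False R)" for T R z x
    proof (rule ccontr)
      assume ne: "h z x \<noteq> h z (branch R)"
      have TM: "T \<subseteq> Pow {..<M}" using T by (rule SM)
      have RM: "R \<subseteq> Pow {..<M}" using R TM side_subset by blast
      have sM: "side False T \<subseteq> Pow {..<M}" "side False R \<subseteq> Pow {..<M}"
        using TM RM side_subset by blast+
      obtain a b where ab: "a \<in> side False T" "b \<in> side False T" "a \<noteq> b" "branch {a, b} = z"
        using levels_pair[OF sM(1) z] by metis
      obtain c d where cd: "c \<in> side False R" "d \<in> side False R" "c \<noteq> d" "branch {c, d} = x"
        using levels_pair[OF sM(2) x] by metis
      obtain e where e: "e \<in> side True R" using side_nonempty[OF RM R(2)] by blast
      let ?E = "{c, d} \<union> {e}"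
      let ?P = "{a, b} \<union> ?E"
      have E: "side False ?E = {c, d}" "side True ?E = {e}" "branch ?E = branch R"
        using cd e by (intro side_join[OF RM]; simp)+
      have ER: "?E \<subseteq> R" using cd e side_subset by blast
      have P: "side False ?P = {a, b}" "side True ?P = ?E"
        using ab ER R(1) by (intro side_join[OF TM]; auto)+
      have cE: "card ?E = 3"
        using cd(1,2,3) e sides_cover(2)[of R] by (subst card_Un_disjoint) auto
      have "card ?P = 5"
        using ab(1,2,3) ER R(1) sides_cover(2)[of T] cE by (subst card_Un_disjoint) auto
      moreover have "fork h ?P"
        unfolding fork_def P E using ab cd cE ne by simp
      moreover have "?P \<subseteq> S"
      proof (rule Un_least)
        show "{a, b} \<subseteq> S" using ab(1,2) T side_subset[of False T] by auto
        show "?E \<subseteq> S" by (intro subset_trans[OF ER] subset_trans[OF R(1)] subset_trans[OF side_subset] T)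
      qed
      ultimately show False using noQ[of ?P] by simp
    qed
    \<comment> \<open>Constant rows give \<open>h x y = h x x\<close> and
      \<open>h y x = h y y\<close>, both false, whereas a tournament orients any two distinct
      levels.\<close>
    have inter: "x = y"
      if T: "T \<subseteq> S" and R: "R \<subseteq> side True T" "2 \<le> card R"
        and xA: "x \<in> levels (side False T)" and yA: "y \<in> levels (side False T)"
        and xB: "x \<in> levels (side False R) \<or> x = branch R"
        and yB: "y \<in> levels (side False R) \<or> y = branch R" for T R x y
    proof (rule ccontr)
      assume "x \<noteq> y"
      have *: "h z x = h z (branch R)" "h z y = h z (branch R)" if "z \<in> levels (side False T)" for z
        using row[OF T R that] xB yB by auto
      have "h x y = h x x" "h y x = h y y" using *[OF xA] *[OF yA] by simp_all
      then show False using irr tour[of x y] tour[of y x] \<open>x \<noteq> y\<close>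
        by (cases x y rule: linorder_cases) auto
    qed
    \<comment> \<open>A ladder on both sides of a node would consist of levels \<open>x < y\<close>
      that \<open>inter\<close> identifies, so \<open>card_blue_le_levels\<close> applies.\<close>
    have small: "card T \<le> ?w" if T: "T \<subseteq> S" "card (levels T) \<le> s" for T
    proof (cases "T = {}")
      case False
      have TM: "T \<subseteq> Pow {..<M}" using T(1) by (rule SM)
      have "card T \<le> 1 + card (levels T) + card (ladders T)"
      proof (rule card_blue_le_levels[OF TM False])
        fix U assume U: "U \<subseteq> T" "2 \<le> card U"
        show "ladders (side False U) \<inter> ladders (side True U) = {}"
        proof (rule ccontr)
          assume "\<not> ?thesis"
          then obtain x y where xy: "(x, y) \<in> ladders (side False U)" "(x, y) \<in> ladders (side True U)" by auto
          obtain R where R: "R \<subseteq> side True U" "2 \<le> card R" "y = branch R" "x \<in> levels (side False R)"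
            using xy(2) by (auto simp: ladders_def)
          have "x \<in> levels (side False U)" "y \<in> levels (side False U)"
            using xy(1) ladders_subset by blast+
          then have "x = y" using inter[of U R x y] R U T(1) by blast
          moreover have "R \<subseteq> Pow {..<M}" using R(1) U(1) TM side_subset by blast
          then have "x < y" using levels_side_less R(3,4) by metis
          ultimately show False by simp
        qed
      qed
      moreover have "card (ladders T) \<le> card (levels T \<times> levels T)"
        using finite_levels[OF TM] by (intro card_mono ladders_subset) simp
      then have "card (ladders T) \<le> s\<^sup>2"
        using T(2) mult_le_mono[of "card (levels T)" s "card (levels T)" s]
        by (simp add: card_cartesian_product power2_eq_square)
      ultimately show ?thesis using T(2) by simp
    qed simp
    \<comment> \<open>Two large left sides would have more than \<open>s\<close> levels each and
      share at most one, leaving disjoint \<open>s\<close>-sets with constant rows.\<close>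
    have alt: "card (side False T) \<le> ?w \<or> card (side False R) \<le> ?w"
      if T: "T \<subseteq> S" and R: "R \<subseteq> side True T" "2 \<le> card R" for T R
    proof (rule ccontr)
      assume big: "\<not> ?thesis"
      have RS: "R \<subseteq> S" using T R(1) side_subset by blast
      have sub: "side False T \<subseteq> S" "side False R \<subseteq> S" using T RS side_subset by blast+
      let ?A = "levels (side False T)" and ?B = "levels (side False R)"
      have "s < card ?A" "s < card ?B" using small[OF sub(1)] small[OF sub(2)] big by force+
      have finA: "finite ?A" "finite ?B" using finite_levels[OF SM] sub by blast+
      have "card (?A \<inter> ?B) \<le> Suc 0"
        using inter[OF T R] finA by (subst card_le_Suc0_iff_eq) auto
      moreover have "card ?A = card (?A - ?B) + card (?A \<inter> ?B)"
        using finA by (metis add.commute card_Diff_subset_Int card_mono finite_Int inf_le1 le_add_diff_inverse)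
      ultimately have "s \<le> card (?A - ?B)" using \<open>s < card ?A\<close> by linarith
      then obtain A where A: "A \<subseteq> ?A - ?B" "card A = s" by (meson obtain_subset_with_card_n)
      obtain B where B: "B \<subseteq> ?B" "card B = s"
        using \<open>s < card ?B\<close> by (meson obtain_subset_with_card_n less_imp_le)
      have "?A \<subseteq> {..<M}" "?B \<subseteq> {..<M}" using levels_subset[OF SM] sub by blast+
      then have "\<not> (\<forall>z \<in> A. \<forall>x \<in> B. \<forall>y \<in> B. h z x = h z y)"
        using A B by (intro mixed) auto
      then obtain z x y where "z \<in> ?A" "x \<in> ?B" "y \<in> ?B" "h z x \<noteq> h z y" using A(1) B(1) by blast
      then show False using row[OF T R] by metis
    qed
    show "card S < 4 * ?w * n\<^sup>2 + 1"
    proof (cases "S = {}")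
      case False
      have fin: "finite S" by (rule finite_vertices[OF S])
      obtain u where u: "u \<in> S" using False by blast
      have "card {u} \<le> n" using u by (intro combs[of _ False] comb_small) auto
      then have n1: "1 \<le> n" by simp
      have path: "card T \<le> c * (2 * n)"
        if T: "T \<subseteq> S" "T \<noteq> {}" and c: "1 \<le> c"
          and bal: "\<And>U. U \<subseteq> T \<Longrightarrow> 2 \<le> card U \<Longrightarrow> \<exists>b. card (side b U) \<le> c" for T c
      proof -
        obtain A B where AB: "A \<subseteq> T" "B \<subseteq> T" "comb False A" "comb True B" "card T \<le> c * (card A + card B)"
          using heavy_path[OF SM[OF T(1)] T(2) c bal] by blast
        have "card A + card B \<le> 2 * n"
          using combs[OF subset_trans[OF AB(1) T(1)] AB(3)] combs[OF subset_trans[OF AB(2) T(1)] AB(4)] by simp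
        then have "c * (card A + card B) \<le> c * (2 * n)" by (rule mult_le_mono2)
        with AB(5) show ?thesis by (rule le_trans)
      qed
      \<comment> \<open>If the left side of a node is large, \<open>alt\<close> bounds the left
        sides of all nodes on its right, and \<open>path\<close> then bounds the whole right side.
        So every node has a side of size at most \<open>?w * (2 * n)\<close>.\<close>
      have "card S \<le> (?w * (2 * n)) * (2 * n)"
      proof (rule path[OF _ False])
        fix T assume T: "T \<subseteq> S" "2 \<le> card T"
        show "\<exists>b. card (side b T) \<le> ?w * (2 * n)"
        proof (cases "card (side False T) \<le> ?w")
          case True
          also have "?w * 1 \<le> ?w * (2 * n)" using n1 by (intro mult_le_mono2) simp
          then have "?w \<le> ?w * (2 * n)" by simp
          finally show ?thesis by blast
        next
          case big: False
          have "card (side True T) \<le> ?w * (2 * n)"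
          proof (rule path)
            show "side True T \<subseteq> S" using T(1) side_subset by blast
            show "side True T \<noteq> {}" using side_nonempty[OF SM[OF T(1)] T(2)] .
            show "1 \<le> ?w" by simp
            show "\<exists>b. card (side b U) \<le> ?w" if "U \<subseteq> side True T" "2 \<le> card U" for U
              using alt[OF T(1) that] big by blast
          qed
          then show ?thesis by blast
        qed
      next
        show "1 \<le> ?w * (2 * n)" using n1 by simp
      qed simp
      also have "\<dots> = 4 * ?w * n\<^sup>2" by (simp add: power2_eq_square algebra_simps)
      finally show ?thesis by simp
    qed simp
  qed
  then show ?thesis by auto
qed

subsection \<open>Upper bound\<close>

text \<open>Without the requirement that \<open>S - {Max S}\<close> be red, the induction on \<open>k\<close> would not gain the
  additional red edge in each step.\<close>

definition forces :: "nat \<Rightarrow> nat \<Rightarrow> nat \<Rightarrow> bool" where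
  "forces k n N \<longleftrightarrow> (\<forall>(V :: nat set) R. finite V \<longrightarrow> N \<le> card V \<longrightarrow>
     (\<exists>S \<subseteq> V. card S = k + 1 \<and> R (S - {Max S}) \<and> k - 1 \<le> card {v \<in> S. R (S - {v})}) \<or>
     (\<exists>S \<subseteq> V. card S = n \<and> (\<forall>e \<subseteq> S. card e = k \<longrightarrow> \<not> R e)))"

lemma forcesD:
  fixes V :: "nat set"
  assumes "forces k n N" "finite V" "N \<le> card V"
  shows "(\<exists>S \<subseteq> V. card S = k + 1 \<and> R (S - {Max S}) \<and> k - 1 \<le> card {v \<in> S. R (S - {v})}) \<or>
     (\<exists>S \<subseteq> V. card S = n \<and> (\<forall>e \<subseteq> S. card e = k \<longrightarrow> \<not> R e))"
  by (rule assms(1)[unfolded forces_def, THEN spec, THEN spec, THEN mp, THEN mp, OF assms(2,3)])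

section \<open>Base case of the upper bound: edges of size three\<close>

text \<open>Scan upwards and keep each vertex that does not complete a red triple with two kept
  ones. A rejected vertex thus lies above its rejecting pair, as the ordered version
  requires.\<close>

lemma greedy_independent:
  fixes V :: "nat set"
  assumes "finite V"
  shows "\<exists>S \<subseteq> V. (\<forall>e \<subseteq> S. card e = 3 \<longrightarrow> \<not> R e) \<and>
    (\<forall>v \<in> V - S. \<exists>a \<in> S. \<exists>b \<in> S. a < b \<and> b < v \<and> R {a, b, v})"
  using assms
proof (induction V rule: finite_linorder_max_induct)
  case (insert w V)
  then obtain S where S: "S \<subseteq> V" "\<forall>e \<subseteq> S. card e = 3 \<longrightarrow> \<not> R e"
    "\<forall>v \<in> V - S. \<exists>a \<in> S. \<exists>b \<in> S. a < b \<and> b < v \<and> R {a, b, v}" by blast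
  show ?case
  proof (cases "\<exists>a \<in> S. \<exists>b \<in> S. a < b \<and> b < w \<and> R {a, b, w}")
    case True
    then show ?thesis using S by (intro exI[of _ S]) auto
  next
    case False
    have "\<not> R e" if e: "e \<subseteq> insert w S" "card e = 3" for e
    proof (cases "w \<in> e")
      case False
      then show ?thesis using S(2) e by blast
    next
      case True
      then have "card (e - {w}) = 2" using e(2) by simp
      then obtain a b where ab: "e - {w} = {a, b}" "a \<noteq> b" by (meson card_2_iff)
      have "a \<in> S" "b \<in> S" using ab e(1) by blast+
      moreover have "e = {a, b, w}" using ab True by blast
      moreover have "a < w" "b < w" using calculation(1,2) S(1) insert.hyps by blast+
      ultimately show ?thesis using False ab(2)
        by (cases a b rule: linorder_cases) (auto simp: insert_commute)
    qed
    moreover have "insert w S \<subseteq> insert w V" using S(1) by auto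
    moreover have "\<exists>a \<in> insert w S. \<exists>b \<in> insert w S. a < b \<and> b < v \<and> R {a, b, v}"
      if "v \<in> insert w V - insert w S" for v using S(3) that by auto
    ultimately show ?thesis by (intro exI[of _ "insert w S"]) simp
  qed
qed simp

text \<open>If fewer than \<open>n\<close> vertices are kept, two rejected ones
  \<open>v < v'\<close> share a rejecting pair. Both triples are red, and the one with
  \<open>v\<close> omits the maximum \<open>v'\<close>.\<close>

lemma forces_3: "forces 3 n (n\<^sup>2)"
  unfolding forces_def
proof (intro allI impI)
  fix V :: "nat set" and R assume fin: "finite V" and V: "n\<^sup>2 \<le> card V"
  obtain S where S: "S \<subseteq> V" "\<forall>e \<subseteq> S. card e = 3 \<longrightarrow> \<not> R e"
    "\<forall>v \<in> V - S. \<exists>a \<in> S. \<exists>b \<in> S. a < b \<and> b < v \<and> R {a, b, v}"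
    using greedy_independent[OF fin, of R] by (elim exE conjE)
  have finS: "finite S" using S(1) fin finite_subset by blast
  show "(\<exists>S \<subseteq> V. card S = 3 + 1 \<and> R (S - {Max S}) \<and> 3 - 1 \<le> card {v \<in> S. R (S - {v})}) \<or>
     (\<exists>S \<subseteq> V. card S = n \<and> (\<forall>e \<subseteq> S. card e = 3 \<longrightarrow> \<not> R e))"
  proof (cases "n \<le> card S")
    case True
    then obtain T where "T \<subseteq> S" "card T = n" by (meson obtain_subset_with_card_n)
    have "T \<subseteq> V" using \<open>T \<subseteq> S\<close> S(1) by simp
    moreover have "\<forall>e \<subseteq> T. card e = 3 \<longrightarrow> \<not> R e" using \<open>T \<subseteq> S\<close> S(2) by simp
    ultimately show ?thesis using \<open>card T = n\<close> by (intro disjI2 exI[of _ T]) simp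
  next
    case False
    have "\<forall>v \<in> V - S. \<exists>q. q \<in> S \<times> S \<and> fst q < snd q \<and> snd q < v \<and> R {fst q, snd q, v}"
    proof
      fix v assume "v \<in> V - S"
      then obtain a b where "a \<in> S" "b \<in> S" "a < b" "b < v" "R {a, b, v}" using S(3) by blast
      then show "\<exists>q. q \<in> S \<times> S \<and> fst q < snd q \<and> snd q < v \<and> R {fst q, snd q, v}"
        by (intro exI[of _ "(a, b)"]) simp
    qed
    from bchoice[OF this]
    obtain q where q: "\<And>v. v \<in> V - S \<Longrightarrow> q v \<in> S \<times> S \<and> fst (q v) < snd (q v) \<and> snd (q v) < v
        \<and> R {fst (q v), snd (q v), v}" by blast
    have "\<not> inj_on q (V - S)"
    proof
      assume "inj_on q (V - S)"
      moreover have "q ` (V - S) \<subseteq> S \<times> S" by (rule image_subsetI) (use q in blast)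
      ultimately have "card (V - S) \<le> card (S \<times> S)" using finS by (intro card_inj_on_le) auto
      then have "card V \<le> card S + card S * card S"
        using card_Diff_subset[OF finS S(1)] by (simp add: card_cartesian_product)
      also have "\<dots> = card S * Suc (card S)" by simp
      also have "\<dots> < n * n" using False by (intro mult_less_le_imp_less) auto
      finally show False using V by (simp add: power2_eq_square)
    qed
    then obtain v v' where v: "v \<in> V - S" "v' \<in> V - S" "v < v'" "q v = q v'"
      by (metis inj_onI linorder_neqE_nat)
    obtain a b where ab: "q v = (a, b)" by fastforce
    have *: "a \<in> S" "b \<in> S" "a < b" "b < v" "R {a, b, v}" "R {a, b, v'}"
      using q[OF v(1)] q[OF v(2)] v(4) ab by auto
    let ?T = "{a, b, v, v'}"
    have "Max ?T = v'" using * v(3) by (intro Max_eqI) auto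
    moreover have "?T - {v'} = {a, b, v}" "?T - {v} = {a, b, v'}" using * v(3) by auto
    moreover have "card {v, v'} \<le> card {u \<in> ?T. R (?T - {u})}"
      using * calculation by (intro card_mono) auto
    ultimately have "card ?T = 3 + 1 \<and> R (?T - {Max ?T}) \<and> 3 - 1 \<le> card {u \<in> ?T. R (?T - {u})}"
      using * v(3) by simp
    moreover have "?T \<subseteq> V" using * v S(1) by blast
    ultimately show ?thesis by blast
  qed
qed

text \<open>The set \<open>B\<close> consists of the vertices already chosen, \<open>W - B\<close> of the remaining candidates.\<close>

definition end_homogeneous :: "nat \<Rightarrow> (nat set \<Rightarrow> bool) \<Rightarrow> nat set \<Rightarrow> nat set \<Rightarrow> bool" where
  "end_homogeneous k R B W \<longleftrightarrow> (\<forall>e \<subseteq> B. card e = k \<longrightarrow>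
     (\<forall>x \<in> W. \<forall>y \<in> W. (\<forall>z \<in> e. z < x \<and> z < y) \<longrightarrow> R (insert x e) = R (insert y e)))"

lemma pigeonhole_fibre:
  assumes "finite S" "f ` S \<subseteq> F" "finite F" "card F * q \<le> card S" "F \<noteq> {}"
  obtains c where "q \<le> card {x \<in> S. f x = c}"
proof (rule ccontr)
  assume "\<not> thesis"
  then have less: "card {x \<in> S. f x = c} < q" for c using that by (meson not_less)
  have "S = (\<Union>c\<in>F. {x \<in> S. f x = c})" using assms(2) by blast
  then have "card S \<le> (\<Sum>c\<in>F. card {x \<in> S. f x = c})" using card_UN_le[OF assms(3)] by metis
  also have "\<dots> < (\<Sum>c\<in>F. q)" using assms(3,5) less by (intro sum_strict_mono) auto
  finally show False using assms(4) by simp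
qed

text \<open>The least candidate is chosen next, and only candidates with equal colours over all
  \<open>k\<close>-sets of chosen vertices are kept. There are at most \<open>2 ^ (m ^ k)\<close>
  colour patterns; the extra factor 2 per step absorbs the loss of the least candidate.\<close>

lemma end_homogeneous_exists:
  assumes "finite B" "finite S" "\<forall>b \<in> B. \<forall>s \<in> S. b < s" "end_homogeneous k R B (B \<union> S)"
    "card B + j = m" "2 ^ (j * (m ^ k + 1)) \<le> card S"
  shows "\<exists>W \<subseteq> B \<union> S. card W = m \<and> end_homogeneous k R W W"
  using assms
proof (induction j arbitrary: B S)
  case 0
  then show ?case by (intro exI[of _ B]) (auto simp: end_homogeneous_def)
next
  case (Suc j)
  let ?q = "2 ^ (j * (m ^ k + 1)) :: nat"
  have "2 * (2 ^ (m ^ k) * ?q) \<le> card S"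
    using Suc.prems(6) by (simp add: power_add mult.assoc mult.left_commute)
  moreover have "1 \<le> 2 ^ (m ^ k) * ?q" by simp
  ultimately have big: "2 ^ (m ^ k) * ?q \<le> card S - 1" and "card S \<noteq> 0" by linarith+
  then have "S \<noteq> {}" by auto
  define v where "v = Min S"
  have vS: "v \<in> S" and vmin: "\<And>x. x \<in> S - {v} \<Longrightarrow> v < x"
    using Suc.prems(2) \<open>S \<noteq> {}\<close> by (auto simp: v_def le_neq_implies_less)
  define E where "E = {e. e \<subseteq> insert v B \<and> card e = k}"
  define f where "f x = {e \<in> E. R (insert x e)}" for x
  have vB: "v \<notin> B" using Suc.prems(3) vS by blast
  have finE: "finite E" using Suc.prems(1) by (simp add: E_def)
  have "card E = Suc (card B) choose k"
    using n_subsets[of "insert v B" k] Suc.prems(1) vB by (simp add: E_def)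
  also have "\<dots> \<le> Suc (card B) ^ k"
    by (cases "k \<le> Suc (card B)") (simp_all only: binomial_le_pow binomial_eq_0 not_le)
  also have "\<dots> \<le> m ^ k" using Suc.prems(5) by (intro power_mono) auto
  finally have "card (Pow E) * ?q \<le> 2 ^ (m ^ k) * ?q"
    using finE by (simp add: card_Pow)
  also have "\<dots> \<le> card (S - {v})" using big vS by simp
  finally have "card (Pow E) * ?q \<le> card (S - {v})" .
  then obtain c where c: "?q \<le> card {x \<in> S - {v}. f x = c}"
    using pigeonhole_fibre[of "S - {v}" f "Pow E" ?q] Suc.prems(2) finE by (auto simp: f_def)
  let ?S = "{x \<in> S - {v}. f x = c}"
  have "\<exists>W \<subseteq> insert v B \<union> ?S. card W = m \<and> end_homogeneous k R W W"
  proof (rule Suc.IH)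
    show "finite (insert v B)" "finite ?S" using Suc.prems(1,2) by auto
    show "\<forall>b \<in> insert v B. \<forall>s \<in> ?S. b < s" using Suc.prems(3) vmin by auto
    show "card (insert v B) + j = m" using Suc.prems(1,5) vB by simp
    show "?q \<le> card ?S" by (rule c)
    show "end_homogeneous k R (insert v B) (insert v B \<union> ?S)"
      unfolding end_homogeneous_def
    proof (intro allI impI ballI)
      fix e x y assume e: "e \<subseteq> insert v B" "card e = k" and x: "x \<in> insert v B \<union> ?S"
        and y: "y \<in> insert v B \<union> ?S" and above: "\<forall>z \<in> e. z < x \<and> z < y"
      show "R (insert x e) = R (insert y e)"
      \<comment> \<open>Only sets through \<open>v\<close> need the new fibre, since everything
        above \<open>v\<close> lies in \<open>?S\<close>; the others inherit homogeneity.\<close>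
      proof (cases "v \<in> e")
        case True
        then have "v < x" "v < y" using above by auto
        then have "x \<in> ?S" "y \<in> ?S" using x y vS Suc.prems(3) by fastforce+
        then have "f x = f y" by simp
        moreover have "e \<in> E" using e by (simp add: E_def)
        ultimately show ?thesis by (auto simp: f_def)
      next
        case False
        then have "e \<subseteq> B" using e(1) by blast
        moreover have "x \<in> B \<union> S" "y \<in> B \<union> S" using x y vS by auto
        ultimately show ?thesis
          using Suc.prems(4) e(2) above unfolding end_homogeneous_def by blast
      qed
    qed
  qed
  then obtain W where "W \<subseteq> insert v B \<union> ?S" "card W = m" "end_homogeneous k R W W" by blast
  moreover have "insert v B \<union> ?S \<subseteq> B \<union> S" using vS by auto
  ultimately show ?case by (intro exI[of _ W]) auto
qed

text \<open>Adding the top vertex \<open>w\<close> of an end-homogeneous set turns \<open>R\<close>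
  into a colouring of \<open>k\<close>-sets. Its \<open>k - 1\<close> red sets become red edges
  through \<open>w\<close>. As \<open>S - {Max S}\<close> is among the red sets, end-homogeneity
  makes \<open>S\<close> itself red: this is the gained edge, and the one that misses the
  maximum.\<close>

lemma forces_Suc:
  assumes k: "1 \<le> k" and F: "forces k n N"
  shows "forces (k + 1) n (2 ^ ((N + 1) * ((N + 1) ^ k + 1)))"
  unfolding forces_def
proof (intro allI impI)
  fix V :: "nat set" and R
  assume fin: "finite V" and V: "2 ^ ((N + 1) * ((N + 1) ^ k + 1)) \<le> card V"
  have "end_homogeneous k R {} ({} \<union> V)" using k by (auto simp: end_homogeneous_def)
  then obtain W where W: "W \<subseteq> V" "card W = N + 1" "end_homogeneous k R W W"
    using end_homogeneous_exists[of "{}" V k R "N + 1" "N + 1"] fin V by auto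
  have finW: "finite W" using W(1) fin finite_subset by blast
  define w where "w = Max W"
  have "W \<noteq> {}" using W(2) by auto
  then have wW: "w \<in> W" and wmax: "\<And>x. x \<in> W - {w} \<Longrightarrow> x < w"
    using finW by (auto simp: w_def le_neq_implies_less)
  have end_hom: "R S = R (insert w (S - {Max S}))" if S: "S \<subseteq> W - {w}" "card S = k + 1" for S
  proof -
    have finS: "finite S" and "S \<noteq> {}" using S(2) by (auto intro: card_ge_0_finite)
    then have M: "Max S \<in> S" "\<And>z. z \<in> S - {Max S} \<Longrightarrow> z < Max S"
      by (auto simp: le_neq_implies_less)
    have "S = insert (Max S) (S - {Max S})" using M(1) by blast
    moreover have "R (insert (Max S) (S - {Max S})) = R (insert w (S - {Max S}))"
    proof -
      have "S - {Max S} \<subseteq> W" "Max S \<in> W" using S(1) M(1) by blast+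
      moreover have "card (S - {Max S}) = k" using S(2) M(1) by simp
      moreover have "\<forall>z \<in> S - {Max S}. z < Max S \<and> z < w" using M(2) S(1) wmax by blast
      ultimately show ?thesis using W(3) wW unfolding end_homogeneous_def by blast
    qed
    ultimately show ?thesis by metis
  qed
  define \<phi> where "\<phi> e = R (insert w e)" for e
  have "N \<le> card (W - {w})" "finite (W - {w})" using W(2) wW finW by auto
  then have "(\<exists>S \<subseteq> W - {w}. card S = k + 1 \<and> \<phi> (S - {Max S}) \<and> k - 1 \<le> card {v \<in> S. \<phi> (S - {v})}) \<or>
     (\<exists>S \<subseteq> W - {w}. card S = n \<and> (\<forall>e \<subseteq> S. card e = k \<longrightarrow> \<not> \<phi> e))"
    by (rule forcesD[OF F, rotated])
  then show "(\<exists>S \<subseteq> V. card S = k + 1 + 1 \<and> R (S - {Max S}) \<and> k + 1 - 1 \<le> card {v \<in> S. R (S - {v})}) \<or>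
     (\<exists>S \<subseteq> V. card S = n \<and> (\<forall>e \<subseteq> S. card e = k + 1 \<longrightarrow> \<not> R e))"
  proof (elim disjE exE conjE)
    fix S assume S: "S \<subseteq> W - {w}" "card S = k + 1" "\<phi> (S - {Max S})" "k - 1 \<le> card {v \<in> S. \<phi> (S - {v})}"
    have finS: "finite S" using S(1) finW finite_subset by blast
    let ?T = "insert w S"
    have wS: "w \<notin> S" using S(1) by blast
    have cT: "card ?T = k + 1 + 1" using wS finS S(2) by simp
    have "Max ?T = w" using finS S(1) wmax by (intro Max_eqI) (auto intro: less_imp_le)
    then have max: "?T - {Max ?T} = S" using wS by simp
    have RS: "R S" using end_hom[OF S(1,2)] S(3) by (simp add: \<phi>_def)
    have "?T - {v} = insert w (S - {v})" if "v \<in> S" for v using that wS by blast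
    then have "insert w {v \<in> S. \<phi> (S - {v})} \<subseteq> {v \<in> ?T. R (?T - {v})}"
      using RS wS by (auto simp: \<phi>_def)
    then have "card (insert w {v \<in> S. \<phi> (S - {v})}) \<le> card {v \<in> ?T. R (?T - {v})}"
      using finS by (intro card_mono) auto
    then have "k + 1 - 1 \<le> card {v \<in> ?T. R (?T - {v})}" using wS finS S(4) by simp
    moreover have "?T \<subseteq> V" using S(1) W(1) wW by blast
    ultimately show ?thesis using cT RS by (intro disjI1 exI[of _ ?T]) (simp add: max)
  next
    fix S assume S: "S \<subseteq> W - {w}" "card S = n" "\<forall>e \<subseteq> S. card e = k \<longrightarrow> \<not> \<phi> e"
    have "\<not> R e" if e: "e \<subseteq> S" "card e = k + 1" for e
    proof -
      have "e \<noteq> {}" "finite e" using e(2) by (auto intro: card_ge_0_finite)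
      then have "card (e - {Max e}) = k" using e(2) by simp
      moreover have "e - {Max e} \<subseteq> S" using e(1) by blast
      ultimately have "\<not> \<phi> (e - {Max e})" using S(3) by blast
      then show ?thesis using end_hom[OF subset_trans[OF e(1) S(1)] e(2)] by (simp add: \<phi>_def)
    qed
    moreover have "S \<subseteq> V" using S(1) W(1) by blast
    ultimately show ?thesis using S(2) by blast
  qed
qed

lemma forces_mono:
  assumes "forces k n N" "N \<le> N'"
  shows "forces k n N'"
  unfolding forces_def
proof (intro allI impI)
  fix V :: "nat set" and R assume V: "finite V" "N' \<le> card V"
  show "(\<exists>S \<subseteq> V. card S = k + 1 \<and> R (S - {Max S}) \<and> k - 1 \<le> card {v \<in> S. R (S - {v})}) \<or>
     (\<exists>S \<subseteq> V. card S = n \<and> (\<forall>e \<subseteq> S. card e = k \<longrightarrow> \<not> R e))"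
    by (rule forcesD[OF assms(1) V(1) le_trans[OF assms(2) V(2)]])
qed

lemma forces_imp_eh_arrow:
  assumes "forces k n N"
  shows "eh_arrow N k (k - 1) n"
  unfolding eh_arrow_def
proof
  fix \<chi> :: "nat set \<Rightarrow> colour"
  have "(\<exists>S \<subseteq> {1..N}. card S = k + 1 \<and> \<chi> (S - {Max S}) = Red \<and> k - 1 \<le> card {v \<in> S. \<chi> (S - {v}) = Red}) \<or>
     (\<exists>S \<subseteq> {1..N}. card S = n \<and> (\<forall>e \<subseteq> S. card e = k \<longrightarrow> \<not> \<chi> e = Red))"
    by (rule forcesD[OF assms]) simp_all
  then show "(\<exists>S \<in> nsets {1..N} (k + 1). k - 1 \<le> card {e \<in> nsets S k. \<chi> e = Red}) \<or>
        (\<exists>S \<in> nsets {1..N} n. \<forall>e \<in> nsets S k. \<chi> e = Blue)"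
  proof (elim disjE exE conjE)
    fix S assume S: "S \<subseteq> {1..N}" "card S = k + 1" "k - 1 \<le> card {v \<in> S. \<chi> (S - {v}) = Red}"
    have finS: "finite S" using S(1) finite_subset by blast
    have "inj_on (\<lambda>v. S - {v}) {v \<in> S. \<chi> (S - {v}) = Red}" by (auto simp: inj_on_def)
    moreover have "(\<lambda>v. S - {v}) ` {v \<in> S. \<chi> (S - {v}) = Red} \<subseteq> {e \<in> nsets S k. \<chi> e = Red}"
      using S(2) finS by (auto simp: nsets_def)
    moreover have "finite {e \<in> nsets S k. \<chi> e = Red}" using finite_imp_finite_nsets[OF finS] by simp
    ultimately have "card {v \<in> S. \<chi> (S - {v}) = Red} \<le> card {e \<in> nsets S k. \<chi> e = Red}"
      by (rule card_inj_on_le)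
    moreover have "S \<in> nsets {1..N} (k + 1)" using S finS by (auto simp: nsets_def)
    ultimately show ?thesis using S(3) le_trans by blast
  next
    fix S assume S: "S \<subseteq> {1..N}" "card S = n" "\<forall>e \<subseteq> S. card e = k \<longrightarrow> \<not> \<chi> e = Red"
    have "\<forall>e \<in> nsets S k. \<chi> e = Blue" using S(3) colour.exhaust by (auto simp: nsets_def)
    moreover have "S \<in> nsets {1..N} n" using S finite_subset by (auto simp: nsets_def)
    ultimately show ?thesis by blast
  qed
qed

subsection \<open>Towers\<close>

fun ntwr :: "nat \<Rightarrow> nat \<Rightarrow> nat" where
  "ntwr 0 x = x"
| "ntwr (Suc i) x = 2 ^ ntwr i x"

text \<open>The indices of \<^const>\<open>ntwr\<close> start at \<open>0\<close>, those of \<^const>\<open>twr\<close> at \<open>1\<close>.\<close>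

lemma twr_ntwr: "twr (Suc i) (real x) = real (ntwr i x)"
  by (induction i) (simp_all add: powr_realpow)

lemma twr_strict_mono: "x < y \<Longrightarrow> twr (Suc i) x < twr (Suc i) y"
  by (induction i) simp_all

lemma ntwr_ge: "x \<le> ntwr i x"
  by (induction i) (auto intro: order.trans less_imp_le[OF less_exp])

text \<open>At each storey the exponent \<open>y\<close> is at least 2, so
  \<open>y * K \<le> y ^ K\<close>, and the power moves one storey down.\<close>

lemma ntwr_power:
  assumes "2 \<le> x" "1 \<le> K"
  shows "ntwr i x ^ K \<le> ntwr i (x ^ K)"
proof (induction i)
  case (Suc i)
  define y where "y = ntwr i x"
  have y: "2 \<le> y" using ntwr_ge[of x i] assms(1) by (simp add: y_def)
  obtain J where J: "K = Suc J" using assms(2) by (cases K) auto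
  have "Suc J \<le> 2 ^ J" using less_exp[of J] by (simp add: Suc_le_eq)
  also have "\<dots> \<le> y ^ J" using y by (rule power_mono) simp
  finally have "y * K \<le> y ^ K" unfolding J power_Suc by (rule mult_le_mono2)
  then have "y * K \<le> ntwr i (x ^ K)" using Suc.IH by (simp add: y_def)
  then show ?case by (simp add: y_def flip: power_mult)
qed simp

section \<open>The lower-bound construction along the tower\<close>

lemma eh_witness_mono: "eh_witness V R k t n \<Longrightarrow> n \<le> n' \<Longrightarrow> eh_witness V R k t n'"
  unfolding eh_witness_def by (meson order_less_le_trans)

lemma eh_witness_image:
  assumes W: "eh_witness V R k t n" and g: "bij_betw g U V"
  shows "eh_witness U (\<lambda>S. R (g ` S)) k t n"
  unfolding eh_witness_def
proof (intro conjI allI impI)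
  fix S assume S: "S \<subseteq> U" and cS: "card S = k + 1"
  have inj: "inj_on g S" using g S by (meson bij_betw_def inj_on_subset)
  have gS: "g ` S \<subseteq> V" using g S by (auto simp: bij_betw_def)
  have del: "g ` (S - {v}) = g ` S - {g v}" if "v \<in> S" for v
    using inj_on_image_set_diff[OF inj, of S "{v}"] that by simp
  have fin: "finite S" using cS by (simp add: card_ge_0_finite)
  have "g ` {v \<in> S. R (g ` (S - {v}))} \<subseteq> {w \<in> g ` S. R (g ` S - {w})}" using del by auto
  then have "card (g ` {v \<in> S. R (g ` (S - {v}))}) \<le> card {w \<in> g ` S. R (g ` S - {w})}"
    using fin by (intro card_mono) auto
  also have "\<dots> < t" using W gS card_image[OF inj] cS unfolding eh_witness_def by simp
  finally show "card {v \<in> S. R (g ` (S - {v}))} < t"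
    using card_image[OF inj_on_subset[OF inj], of "{v \<in> S. R (g ` (S - {v}))}"] by auto
next
  fix S assume S: "S \<subseteq> U" and fin: "finite S" and free: "\<forall>e \<subseteq> S. card e = k \<longrightarrow> \<not> R (g ` e)"
  have inj: "inj_on g S" using g S by (meson bij_betw_def inj_on_subset)
  have gS: "g ` S \<subseteq> V" using g S by (auto simp: bij_betw_def)
  have "\<not> R e" if e: "e \<subseteq> g ` S" "card e = k" for e
  proof -
    obtain d where d: "d \<subseteq> S" "e = g ` d" using e(1) by (rule subset_imageE)
    then have "card d = k" using e(2) card_image[OF inj_on_subset[OF inj d(1)]] by simp
    then show ?thesis using free d by blast
  qed
  then have "card (g ` S) < n" using W gS fin unfolding eh_witness_def by simp
  then show "card S < n" using card_image[OF inj] by simp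
qed

lemma eh_witness_Pow:
  assumes "eh_witness (Pow {..<M}) R k t n"
  shows "\<exists>R. eh_witness {..<2 ^ M :: nat} R k t n"
proof -
  have "card {..<2 ^ M :: nat} = card (Pow {..<M})" by (simp add: card_Pow)
  then obtain g where "bij_betw g {..<2 ^ M :: nat} (Pow {..<M})"
    using finite_same_card_bij[of "{..<2 ^ M :: nat}" "Pow {..<M}"] by auto
  then show ?thesis using eh_witness_image[OF assms] by blast
qed

text \<open>Each step adds an exponential while the blue bound stays polynomial in \<open>p\<close>.
  Using one \<open>C\<close> as factor and exponent suffices, since \<open>p\<close> is at least
  1.\<close>

lemma eh_witness_tower:
  assumes "4 \<le> k"
  shows "\<exists>C \<ge> 1. \<forall>p \<ge> 1. \<exists>R. eh_witness {..<ntwr (k - 3) p} R k (k - 1) (C * p ^ C)"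
  using assms
proof (induction k rule: dec_induct)
  case base
  have "\<exists>R. eh_witness {..<ntwr 1 p} R 4 3 (3 * p ^ 3)" if p: "1 \<le> p" for p
  proof -
    have "p ^ 1 \<le> p ^ 3" using p by (intro power_increasing) auto
    then have "p + 2 \<le> 3 * p ^ 3" using p by simp
    then show ?thesis using eh_witness_Pow[OF eh_witness_4[of p]] eh_witness_mono by fastforce
  qed
  then show ?case by (intro exI[of _ 3]) simp
next
  case (step k)
  show ?case
  proof (cases "k = 4")
    case True
    have "\<exists>R. eh_witness {..<ntwr 2 p} R 5 4 (757 * p ^ 757)" if p: "1 \<le> p" for p
    proof -
      obtain \<phi> where \<phi>: "eh_witness {..<2 ^ p :: nat} \<phi> 4 3 (p + 2)"
        using eh_witness_Pow[OF eh_witness_4[of p]] by blast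
      \<comment> \<open>The \<open>2 ^ p\<close> vertices for edges of size four become the levels,
        so patterns of size linear in \<open>p\<close> can be excluded.\<close>
      let ?s = "2 * p + 2"
      obtain h :: "nat \<Rightarrow> nat \<Rightarrow> bool" where h: "\<forall>x. \<not> h x x" "\<forall>x y. x < y \<longrightarrow> h x y \<noteq> h y x"
        "\<forall>A B. A \<subseteq> {..<2 ^ p} \<longrightarrow> B \<subseteq> {..<2 ^ p} \<longrightarrow> A \<inter> B = {} \<longrightarrow> card A = ?s \<longrightarrow> card B = ?s \<longrightarrow>
          \<not> (\<forall>z \<in> A. \<forall>x \<in> B. \<forall>y \<in> B. h z x = h z y)"
        using random_tournament[of "2 ^ p" p ?s] by auto
      have "\<exists>R. eh_witness (Pow {..<(2::nat) ^ p}) R 5 4 (4 * (1 + ?s + ?s\<^sup>2) * (p + 2)\<^sup>2 + 1)"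
        by (rule step_up_5[OF \<phi>, of h]) (use h in blast)+
      then obtain R where R: "eh_witness (Pow {..<(2::nat) ^ p}) R 5 4 (4 * (1 + ?s + ?s\<^sup>2) * (p + 2)\<^sup>2 + 1)" ..
      have "?s \<le> 4 * p" using p by simp
      then have s: "?s\<^sup>2 \<le> 16 * p\<^sup>2" using power_mono[of ?s "4 * p" 2] by (simp add: power_mult_distrib)
      have pp: "1 \<le> p\<^sup>2" "p \<le> p\<^sup>2" using p by (simp_all add: power2_eq_square)
      have "1 + ?s + ?s\<^sup>2 \<le> 21 * p\<^sup>2" using s pp by simp
      moreover have "(p + 2)\<^sup>2 \<le> 9 * p\<^sup>2"
        using power_mono[of "p + 2" "3 * p" 2] p by (simp add: power_mult_distrib)
      ultimately have "4 * (1 + ?s + ?s\<^sup>2) * (p + 2)\<^sup>2 \<le> 4 * (21 * p\<^sup>2) * (9 * p\<^sup>2)"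
        by (intro mult_le_mono) auto
      also have "\<dots> = 756 * p ^ 4" by (simp add: power_add[symmetric])
      finally have "4 * (1 + ?s + ?s\<^sup>2) * (p + 2)\<^sup>2 \<le> 756 * p ^ 4" .
      moreover have "1 \<le> p ^ 4" using p by simp
      \<comment> \<open>The constant 757 is \<open>4 * 21 * 9 + 1\<close>; the last summand is
        absorbed by \<open>p ^ 4\<close>.\<close>
      ultimately have "4 * (1 + ?s + ?s\<^sup>2) * (p + 2)\<^sup>2 + 1 \<le> 757 * p ^ 4" by linarith
      also have "\<dots> \<le> 757 * p ^ 757" using p by (intro mult_le_mono2 power_increasing) auto
      finally have "eh_witness (Pow {..<(2::nat) ^ p}) R 5 4 (757 * p ^ 757)" by (rule eh_witness_mono[OF R])
      from eh_witness_Pow[OF this] show ?thesis by (simp add: numeral_2_eq_2)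
    qed
    then show ?thesis unfolding True by (intro exI[of _ 757]) simp
  next
    case False
    then have k: "5 \<le> k" using step by simp
    obtain C where C: "1 \<le> C" "\<forall>p \<ge> 1. \<exists>R. eh_witness {..<ntwr (k - 3) p} R k (k - 1) (C * p ^ C)"
      using step.IH by blast
    let ?D = "2 * k * C + 1"
    have "\<exists>R. eh_witness {..<ntwr (Suc k - 3) p} R (Suc k) (Suc k - 1) (?D * p ^ ?D)" if p: "1 \<le> p" for p
    proof -
      obtain \<phi> where "eh_witness {..<ntwr (k - 3) p} \<phi> k (k - 1) (C * p ^ C)" using C(2) p by blast
      then obtain R where R: "eh_witness (Pow {..<ntwr (k - 3) p}) R (k + 1) k (2 * k * (C * p ^ C) + 1)"
        using step_up_large[OF k] by blast
      have "2 * k * (C * p ^ C) + 1 \<le> ?D * p ^ C" using p by (simp add: Suc_le_eq)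
      also have "\<dots> \<le> ?D * p ^ ?D"
      proof (intro mult_le_mono2 power_increasing)
        have "C \<le> 2 * k * C" using k by simp
        then show "C \<le> ?D" by linarith
      qed (rule p)
      finally have "eh_witness (Pow {..<ntwr (k - 3) p}) R (k + 1) k (?D * p ^ ?D)"
        by (rule eh_witness_mono[OF R])
      moreover have "Suc k - 3 = Suc (k - 3)" using k by simp
      ultimately show ?thesis using eh_witness_Pow by fastforce
    qed
    then show ?thesis by (intro exI[of _ ?D]) simp
  qed
qed

section \<open>From witnesses to the Ramsey number\<close>

lemma eh_arrow_mono:
  assumes "eh_arrow N k t n" "N \<le> N'"
  shows "eh_arrow N' k t n"
proof -
  have "nsets {1..N} m \<subseteq> nsets {1..N'} m" for m using assms(2) by (intro nsets_mono) auto
  then show ?thesis using assms(1) unfolding eh_arrow_def by (meson subsetD)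
qed

text \<open>A witness refutes the arrow for \<open>N\<close>, and the arrow is monotone in
  \<open>N\<close>. Each edge inside \<open>S\<close> is \<open>S - {v}\<close> for one
  \<open>v\<close>, so red edges may be counted by missed vertices.\<close>

lemma eh_witness_less_ramsey:
  assumes "eh_witness {..<N :: nat} R k t n" "t \<le> k + 1"
  shows "N < eh_ramsey k t n"
proof (rule ccontr)
  assume "\<not> N < eh_ramsey k t n"
  moreover have "eh_arrow (eh_ramsey k t n) k t n"
    unfolding eh_ramsey_def using eh_arrow_exists[OF assms(2)] by (rule LeastI_ex)
  ultimately have arrow: "eh_arrow N k t n" using eh_arrow_mono by simp
  have "card {1..N} = card {..<N}" by simp
  then obtain g where g: "bij_betw g {1..N} {..<N}"
    using finite_same_card_bij[of "{1..N}" "{..<N}"] by auto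
  define Q where "Q S = R (g ` S)" for S
  have W: "eh_witness {1..N} Q k t n" using eh_witness_image[OF assms(1) g] by (simp add: Q_def[abs_def])
  define \<chi> where "\<chi> e = (if Q e then Red else Blue)" for e
  from arrow consider S where "S \<in> nsets {1..N} (k + 1)" "t \<le> card {e \<in> nsets S k. \<chi> e = Red}"
    | S where "S \<in> nsets {1..N} n" "\<forall>e \<in> nsets S k. \<chi> e = Blue"
    unfolding eh_arrow_def by meson
  then show False
  proof cases
    case 1
    then have S: "S \<subseteq> {1..N}" "finite S" "card S = k + 1" by (auto simp: nsets_def)
    have "{e \<in> nsets S k. \<chi> e = Red} \<subseteq> (\<lambda>v. S - {v}) ` {v \<in> S. Q (S - {v})}"
    proof
      fix e assume e: "e \<in> {e \<in> nsets S k. \<chi> e = Red}"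
      then have es: "e \<subseteq> S" "card e = k" "Q e" by (auto simp: nsets_def \<chi>_def split: if_splits)
      then have "card (S - e) = 1" using S card_Diff_subset[of e S] finite_subset by fastforce
      then obtain v where "S - e = {v}" by (rule card_1_singletonE)
      then have "v \<in> S" "e = S - {v}" using es(1) by auto
      then show "e \<in> (\<lambda>v. S - {v}) ` {v \<in> S. Q (S - {v})}" using es(3) by auto
    qed
    then have "card {e \<in> nsets S k. \<chi> e = Red} \<le> card {v \<in> S. Q (S - {v})}"
      using S(2) by (intro surj_card_le) auto
    also have "\<dots> < t" using W S unfolding eh_witness_def by simp
    finally show False using 1 by simp
  next
    case 2
    then have S: "S \<subseteq> {1..N}" "finite S" "card S = n" by (auto simp: nsets_def)
    have "\<not> Q e" if e: "e \<subseteq> S" "card e = k" for e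
    proof -
      have "e \<in> nsets S k" using e S(2) finite_subset by (auto simp: nsets_def)
      then have "\<chi> e = Blue" using 2(2) by blast
      then show ?thesis by (auto simp: \<chi>_def)
    qed
    then have "\<forall>e \<subseteq> S. card e = k \<longrightarrow> \<not> Q e" by blast
    then have "card S < n" using W S unfolding eh_witness_def by blast
    then show False using S(3) by simp
  qed
qed

section \<open>The upper bound along the tower\<close>

lemma forces_tower:
  assumes "3 \<le> k"
  shows "\<exists>c \<ge> 1. \<forall>n \<ge> 2. forces k n (ntwr (k - 3) (n ^ c))"
  using assms
proof (induction k rule: dec_induct)
  case base
  then show ?case using forces_3 by (intro exI[of _ 2]) simp
next
  case (step k)
  obtain c where c: "1 \<le> c" "\<forall>n \<ge> 2. forces k n (ntwr (k - 3) (n ^ c))" using step.IH by blast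
  \<comment> \<open>With \<open>N + 1 \<le> N\<^sup>2\<close> and \<open>2 \<le> N\<close>, the
    exponent in \<open>forces_Suc\<close> is at most
    \<open>N\<^sup>2 * (N * N ^ (2 * k))\<close>.\<close>
  define K where "K = 2 * k + 3"
  have "forces (Suc k) n (ntwr (Suc k - 3) (n ^ (c * K)))" if n: "2 \<le> n" for n
  proof -
    define N where "N = ntwr (k - 3) (n ^ c)"
    have nc: "2 \<le> n ^ c" using n c(1) self_le_power[of n c] by simp
    then have N: "2 \<le> N" using ntwr_ge[of "n ^ c" "k - 3"] by (simp add: N_def)
    have "N + 1 \<le> 2 * N" using N by simp
    also have "\<dots> \<le> N\<^sup>2" using N by (simp add: power2_eq_square)
    finally have N2: "N + 1 \<le> N\<^sup>2" .
    have "(N + 1) ^ k \<le> (N\<^sup>2) ^ k" using N2 by (rule power_mono) simp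
    also have "\<dots> = N ^ (2 * k)" by (simp add: power_mult)
    finally have "(N + 1) ^ k + 1 \<le> N ^ (2 * k) + N ^ (2 * k)"
      using N by (intro add_mono) simp_all
    also have "\<dots> \<le> N * N ^ (2 * k)" using N by (simp flip: mult_2)
    finally have "(N + 1) * ((N + 1) ^ k + 1) \<le> N\<^sup>2 * (N * N ^ (2 * k))"
      using N2 by (intro mult_le_mono)
    also have "\<dots> = N ^ K" by (simp add: K_def power_add power2_eq_square power3_eq_cube)
    also have "\<dots> \<le> ntwr (k - 3) ((n ^ c) ^ K)"
      unfolding N_def using nc by (intro ntwr_power) (simp_all add: K_def)
    finally have "(N + 1) * ((N + 1) ^ k + 1) \<le> ntwr (k - 3) (n ^ (c * K))"
      unfolding power_mult .
    then have "2 ^ ((N + 1) * ((N + 1) ^ k + 1)) \<le> (2::nat) ^ ntwr (k - 3) (n ^ (c * K))"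
      by (rule power_increasing) simp
    moreover have "forces (k + 1) n (2 ^ ((N + 1) * ((N + 1) ^ k + 1)))"
      using c(2) n step.hyps unfolding N_def by (intro forces_Suc) simp_all
    ultimately have "forces (k + 1) n (2 ^ ntwr (k - 3) (n ^ (c * K)))" using forces_mono by blast
    moreover have "Suc k - 3 = Suc (k - 3)" using step.hyps by simp
    ultimately show ?thesis by simp
  qed
  moreover have "1 \<le> c * K" using c(1) by (simp add: K_def)
  ultimately show ?case by blast
qed

theorem theorem1:
  fixes k :: nat
  assumes "k \<ge> 4"
  shows "\<exists>c > 0. \<exists>c' > 0. \<forall>\<^sub>F n :: nat in sequentially.
           twr (k - 2) (real n powr c) < real (eh_ramsey k (k - 1) n) \<and>
           real (eh_ramsey k (k - 1) n) < twr (k - 2) (real n powr c')"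
proof -
  have k2: "k - 2 = Suc (k - 3)" using assms by simp
  obtain C where C: "1 \<le> C" "\<forall>p \<ge> 1. \<exists>R. eh_witness {..<ntwr (k - 3) p} R k (k - 1) (C * p ^ C)"
    using eh_witness_tower[OF assms] by blast
  obtain c where c: "1 \<le> c" "\<forall>n \<ge> 2. forces k n (ntwr (k - 3) (n ^ c))"
    using forces_tower[of k] assms by auto
  \<comment> \<open>For \<open>p\<close> about \<open>n powr a\<close>, the blue bound
    \<open>C * p ^ C\<close> is then a constant times the square root of \<open>n\<close>.\<close>
  define a where "a = 1 / (2 * real C)"
  have a: "0 < a" "a * real C = 1 / 2" using C(1) by (simp_all add: a_def)
  have upper: "real (eh_ramsey k (k - 1) n) < twr (k - 2) (real n powr (real c + 1))" if n: "2 \<le> n" for n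
  proof -
    have "eh_ramsey k (k - 1) n \<le> ntwr (k - 3) (n ^ c)"
      unfolding eh_ramsey_def using c(2) n forces_imp_eh_arrow by (intro Least_le) blast
    then have "real (eh_ramsey k (k - 1) n) \<le> twr (k - 2) (real (n ^ c))"
      unfolding k2 twr_ntwr by simp
    also have "real (n ^ c) < real n powr (real c + 1)"
      using n by (simp add: powr_add powr_realpow)
    then have "twr (k - 2) (real (n ^ c)) < twr (k - 2) (real n powr (real c + 1))"
      unfolding k2 by (rule twr_strict_mono)
    finally show ?thesis .
  qed
  have lower: "twr (k - 2) (real n powr a) < real (eh_ramsey k (k - 1) n)"
    if n: "(C * 2 ^ C)\<^sup>2 \<le> n" for n
  proof -
    have "1 \<le> (C * 2 ^ C)\<^sup>2" using C(1) by simp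
    then have n1: "1 \<le> real n" using n by linarith
    \<comment> \<open>Rounding up keeps the tower over \<open>p\<close> large enough and costs at
      most a factor 2, since \<open>n powr a\<close> is at least 1. This factor is the source of
      \<open>2 ^ C\<close> in the threshold for \<open>n\<close>.\<close>
    define p where "p = nat \<lceil>real n powr a\<rceil>"
    have na: "1 \<le> real n powr a" using n1 a(1) by (simp add: ge_one_powr_ge_zero)
    have p: "real n powr a \<le> real p" "real p \<le> 2 * real n powr a"
      using na unfolding p_def by linarith+
    have p1: "1 \<le> p" using p(1) na by linarith
    have "real (C * p ^ C) \<le> real C * (2 * real n powr a) ^ C"
      unfolding of_nat_mult of_nat_power using p(2) by (intro mult_left_mono power_mono) simp_all
    also have "(2 * real n powr a) ^ C = 2 ^ C * real n powr (a * real C)"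
      using n1 by (simp add: power_mult_distrib powr_powr flip: powr_realpow)
    also have "real n powr (a * real C) = sqrt (real n)"
      using n1 by (simp add: a(2) powr_half_sqrt)
    also have "real C * (2 ^ C * sqrt (real n)) = real (C * 2 ^ C) * sqrt (real n)" by simp
    also have "\<dots> \<le> sqrt (real n) * sqrt (real n)"
    proof (rule mult_right_mono)
      have "(real (C * 2 ^ C))\<^sup>2 \<le> real n" using n by (metis of_nat_le_iff of_nat_power)
      then show "real (C * 2 ^ C) \<le> sqrt (real n)" by (rule real_le_rsqrt)
    qed simp
    also have "\<dots> = real n" by simp
    finally have "C * p ^ C \<le> n" unfolding of_nat_le_iff .
    moreover obtain R where "eh_witness {..<ntwr (k - 3) p} R k (k - 1) (C * p ^ C)" using C(2) p1 by blast
    ultimately have "eh_witness {..<ntwr (k - 3) p} R k (k - 1) n" using eh_witness_mono by blast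
    then have less: "ntwr (k - 3) p < eh_ramsey k (k - 1) n" by (rule eh_witness_less_ramsey) simp
    have "twr (k - 2) (real n powr a) \<le> twr (k - 2) (real p)"
      using p(1) twr_strict_mono[of "real n powr a" "real p"] unfolding k2
      by (cases "real n powr a = real p") (auto intro: less_imp_le)
    also have "\<dots> < real (eh_ramsey k (k - 1) n)" unfolding k2 twr_ntwr using less by simp
    finally show ?thesis .
  qed
  have "\<forall>\<^sub>F n in sequentially. max 2 ((C * 2 ^ C)\<^sup>2) \<le> n" by (rule eventually_ge_at_top)
  then have "\<forall>\<^sub>F n :: nat in sequentially.
           twr (k - 2) (real n powr a) < real (eh_ramsey k (k - 1) n) \<and>
           real (eh_ramsey k (k - 1) n) < twr (k - 2) (real n powr (real c + 1))"
    by (rule eventually_mono) (use upper lower in simp)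
  then show ?thesis using a(1) by (intro exI[of _ a] conjI exI[of _ "real c + 1"]) simp_all
qed

end
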